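(* Let $n\ge 3$, let $R=k[x_1,\dots,x_n]$ and let $J=(F_1,\dots,F_n)\subset R$ be a complete intersection of general forms with $\deg F_i=d_i$ for $1\le i\le n$. Assume $2<d_1\le\dots\le d_n$. Let $d=d_1+\dots+d_n$. Choose general forms $F_{n+1},\dots,F_{2n-2}$ all of degree $d-n-1$, and let $I=(F_1,\dots,F_n,F_{n+1},\dots,F_{2n-2})$. Then $R/I$ has a ghost term of the form $R(-d+2)$ occurring in the last (the $n$-th) and the penultimate (the $(n-1)$-st) free modules of its minimal graded free resolution, and this ghost term does not arise from any Koszul syzygies (i.e. it is non-Koszul).
   Context: $k$ is an infinite field and $R$ is standard graded. "General forms" of prescribed degrees means: the statement holds for all tuples of forms in a nonempty Zariski open subset of the product of the corresponding spaces $R_{\deg F_i}$. Write the minimal graded free resolution of $R/I$ as $0\to\mathbb F_n\to\dots\to\mathbb F_2\to\mathbb F_1\to R\to R/I\to 0$; $\mathbb F_i$ is called the $i$-th free module. A ghost term $R(-t)$ between the $i$-th and the $(i+1)$-st free modules means that $R(-t)$ occurs as a direct summand of both $\mathbb F_i$ and $\mathbb F_{i+1}$. Let $K_\bullet$ be the Koszul complex on the given generators of $I$, so $K_i=\bigoplus R(-(\deg F_{j_1}+\dots+\deg F_{j_i}))$ over $j_1<\dots<j_i$. A comparison map $K_\bullet\to\mathbb F_\bullet$ over the identity of $R/I$ induces a well-defined map $(K_i\otimes_R k)_t\to(\mathbb F_i\otimes_R k)_t=\mathrm{Tor}_i^R(R/I,k)_t$. The copies of $R(-t)$ in $\mathbb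 F_i$ are called Koszul ($i$-th Koszul syzygies) if this map is surjective. A ghost term $R(-t)$ between the $i$-th and $(i+1)$-st free modules is said to arise from Koszul syzygies (to be Koszul) if the copies of $R(-t)$ in $\mathbb F_{i+1}$ are Koszul; otherwise it is non-Koszul. *)

theory Defs
  imports Complex_Main "HOL-Library.Poly_Mapping" "HOL-Library.FuncSet"
    "HOL-Library.Cardinality"
begin

text \<open>The polynomial ring over \<open>'k\<close> in the variables \<open>x\<^sub>v\<close>, \<open>v :: 'n\<close>. A monomial is
  its exponent vector; \<open>lookup p 0\<close> is the constant coefficient of \<open>p\<close>.\<close>

type_synonym ('n, 'k) mpoly = "('n \<Rightarrow>\<^sub>0 nat) \<Rightarrow>\<^sub>0 'k"

definition mdeg :: "('n \<Rightarrow>\<^sub>0 nat) \<Rightarrow> nat" where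
  "mdeg m = (\<Sum>v\<in>Poly_Mapping.keys m. Poly_Mapping.lookup m v)"

text \<open>The graded piece of degree \<open>t\<close> (it contains \<open>0\<close>).\<close>

definition forms :: "nat \<Rightarrow> ('n, 'k::zero) mpoly set" where
  "forms t = {p. \<forall>m\<in>Poly_Mapping.keys p. mdeg m = t}"

definition ideal_gen :: "'a::comm_ring_1 set \<Rightarrow> 'a set" where
  "ideal_gen S = module.span (*) S"

definition regular_sequence :: "nat \<Rightarrow> (nat \<Rightarrow> 'a::comm_ring_1) \<Rightarrow> bool" where
  "regular_sequence r F \<longleftrightarrow>
     (\<forall>i\<in>{1..r}. \<forall>g. g * F i \<in> ideal_gen (F ` {1..<i}) \<longrightarrow> g \<in> ideal_gen (F ` {1..<i})) \<and>
     1 \<notin> ideal_gen (F ` {1..r})"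


section \<open>General forms\<close>

text \<open>A point of the product of the spaces of forms of degrees \<open>e 1, \<dots>, e N\<close> has the
  coordinates \<open>lookup (F i) m\<close>, so polynomial functions on the product are given by
  polynomials in variables indexed by pairs \<open>(i, m)\<close>. Variables whose pair is not a genuine
  coordinate (\<open>i\<close> outside \<open>{1..N}\<close> or \<open>mdeg m \<noteq> e i\<close>) take a constant value on the product.\<close>

definition form_tuples :: "nat \<Rightarrow> (nat \<Rightarrow> nat) \<Rightarrow> (nat \<Rightarrow> ('n, 'k::zero) mpoly) set" where
  "form_tuples N e = (\<Pi>\<^sub>E i\<in>{1..N}. forms (e i))"

definition eval_poly :: "('v, 'k) mpoly \<Rightarrow> ('v \<Rightarrow> 'k) \<Rightarrow> 'k::comm_semiring_1" where
  "eval_poly P x = (\<Sum>m\<in>Poly_Mapping.keys P.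
     Poly_Mapping.lookup P m * (\<Prod>v\<in>Poly_Mapping.keys m. x v ^ Poly_Mapping.lookup m v))"

definition zariski_open ::
  "nat \<Rightarrow> (nat \<Rightarrow> nat) \<Rightarrow> (nat \<Rightarrow> ('n, 'k::field) mpoly) set \<Rightarrow> bool" where
  "zariski_open N e U \<longleftrightarrow>
     (\<exists>S :: (nat \<times> ('n \<Rightarrow>\<^sub>0 nat), 'k) mpoly set.
        U = {F \<in> form_tuples N e. \<exists>P\<in>S. eval_poly P (\<lambda>(i, m). Poly_Mapping.lookup (F i) m) \<noteq> 0})"

definition for_general_forms ::
  "nat \<Rightarrow> (nat \<Rightarrow> nat) \<Rightarrow> ((nat \<Rightarrow> ('n, 'k::field) mpoly) \<Rightarrow> bool) \<Rightarrow> bool" where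
  "for_general_forms N e Q \<longleftrightarrow> (\<exists>U. zariski_open N e U \<and> U \<noteq> {} \<and> (\<forall>F\<in>U. Q F))"


section \<open>Graded free resolutions\<close>

text \<open>A sequence of finitely generated graded free modules over \<open>R = 'a\<close> and maps,
  in homological degrees \<open>0, 1, 2, \<dots>\<close>. The \<open>i\<close>-th module is the direct sum of \<open>R(- shift C i b)\<close> over
  \<open>b \<in> basis C i\<close>; \<open>diff C i r c\<close> is the matrix entry of the map from the \<open>i\<close>-th to the
  \<open>(i-1)\<close>-st module in row \<open>r \<in> basis C (i-1)\<close> and column \<open>c \<in> basis C i\<close>. It is only
  meaningful for \<open>i \<ge> 1\<close>. Natural numbers suffice as shifts, because the modules \<open>R/I\<close>
  and their resolutions live in nonnegative degrees.\<close>

record ('b, 'a) graded_seq =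
  basis :: "nat \<Rightarrow> 'b set"
  shift :: "nat \<Rightarrow> 'b \<Rightarrow> nat"
  diff :: "nat \<Rightarrow> 'b \<Rightarrow> 'b \<Rightarrow> 'a"

text \<open>Entries of a degree-preserving map \<open>R(-a) \<rightarrow> R(-b)\<close>: forms of degree \<open>a - b\<close>,
  hence \<open>0\<close> if \<open>a < b\<close>.\<close>

definition graded_entry :: "nat \<Rightarrow> nat \<Rightarrow> ('n, 'k::zero) mpoly \<Rightarrow> bool" where
  "graded_entry a b p \<longleftrightarrow> (\<forall>m\<in>Poly_Mapping.keys p. mdeg m + b = a)"

definition mat_app :: "'c set \<Rightarrow> ('b \<Rightarrow> 'c \<Rightarrow> 'a) \<Rightarrow> ('c \<Rightarrow> 'a) \<Rightarrow> 'b \<Rightarrow> 'a::comm_semiring_1" where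
  "mat_app B M f r = (\<Sum>c\<in>B. M r c * f c)"

text \<open>The augmentation is the canonical map \<open>R \<rightarrow> R/I\<close>, so exactness in homological
  degree \<open>0\<close> says that the image of \<open>diff C 1\<close> is \<open>I\<close>.\<close>

definition graded_free_resolution ::
  "('n, 'k::field) mpoly set \<Rightarrow> ('b, ('n, 'k) mpoly) graded_seq \<Rightarrow> bool" where
  "graded_free_resolution I C \<longleftrightarrow>
     (\<forall>i. finite (basis C i)) \<and>
     (\<forall>i. \<forall>r\<in>basis C i. \<forall>c\<in>basis C (Suc i).
        graded_entry (shift C (Suc i) c) (shift C i r) (diff C (Suc i) r c)) \<and>
     (\<exists>b. basis C 0 = {b} \<and> shift C 0 b = 0 \<and>
        I = {mat_app (basis C 1) (diff C 1) f b | f. True}) \<and>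
     (\<forall>i f. (\<forall>r\<in>basis C i. mat_app (basis C (Suc i)) (diff C (Suc i)) f r = 0) \<longleftrightarrow>
        (\<exists>g. \<forall>c\<in>basis C (Suc i).
           f c = mat_app (basis C (Suc (Suc i))) (diff C (Suc (Suc i))) g c))"

text \<open>Minimality: the image of each map lies in \<open>(x\<^sub>v)\<^sub>v\<close> times its target. By Hilbert's
  syzygy theorem the minimal resolution has length at most the number of variables, as in
  \<open>0 \<rightarrow> F\<^sub>n \<rightarrow> \<dots> \<rightarrow> F\<^sub>1 \<rightarrow> R\<close>.\<close>

definition minimal_graded_free_resolution ::
  "('n::finite, 'k::field) mpoly set \<Rightarrow> ('b, ('n, 'k) mpoly) graded_seq \<Rightarrow> bool" where
  "minimal_graded_free_resolution I C \<longleftrightarrow>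
     graded_free_resolution I C \<and>
     (\<forall>i. \<forall>r\<in>basis C i. \<forall>c\<in>basis C (Suc i). Poly_Mapping.lookup (diff C (Suc i) r c) 0 = 0) \<and>
     (\<forall>i > CARD('n). basis C i = {})"

text \<open>The basis elements that generate the copies of \<open>R(-t)\<close> in the \<open>i\<close>-th module.\<close>

definition copies :: "('b, 'a) graded_seq \<Rightarrow> nat \<Rightarrow> nat \<Rightarrow> 'b set" where
  "copies C i t = {b \<in> basis C i. shift C i b = t}"

definition ghost_term :: "('b, 'a) graded_seq \<Rightarrow> nat \<Rightarrow> nat \<Rightarrow> bool" where
  "ghost_term C i t \<longleftrightarrow> copies C i t \<noteq> {} \<and> copies C (Suc i) t \<noteq> {}"


section \<open>Koszul syzygies\<close>

text \<open>Basis of the \<open>i\<close>-th module: the \<open>i\<close>-element subsets \<open>S\<close> of \<open>{1..N}\<close>, with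
  \<open>e\<^sub>S \<mapsto> \<Sum>j\<in>S. (-1)^|{s\<in>S. s < j}| F\<^sub>j e\<^bsub>S - {j}\<^esub>\<close>.\<close>

definition koszul ::
  "nat \<Rightarrow> (nat \<Rightarrow> nat) \<Rightarrow> (nat \<Rightarrow> ('n, 'k::field) mpoly) \<Rightarrow> (nat set, ('n, 'k) mpoly) graded_seq" where
  "koszul N e F =
     \<lparr> basis = (\<lambda>i. {S. S \<subseteq> {1..N} \<and> card S = i}),
       shift = (\<lambda>i S. \<Sum>j\<in>S. e j),
       diff = (\<lambda>i T S. \<Sum>j\<in>{j\<in>S. T = S - {j}}. (-1) ^ card {s\<in>S. s < j} * F j) \<rparr>"

text \<open>Degree-preserving chain maps \<open>K \<rightarrow> C\<close> over the identity of \<open>R/I\<close>, where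
  \<open>\<alpha> i r c\<close> is the entry of the \<open>i\<close>-th component in row \<open>r \<in> basis C i\<close> and column
  \<open>c \<in> basis K i\<close>, and both modules in homological degree \<open>0\<close> are \<open>R\<close>.\<close>

definition comparison_map ::
  "('n, 'k::field) mpoly set \<Rightarrow> ('c, ('n, 'k) mpoly) graded_seq \<Rightarrow> ('b, ('n, 'k) mpoly) graded_seq
     \<Rightarrow> (nat \<Rightarrow> 'b \<Rightarrow> 'c \<Rightarrow> ('n, 'k) mpoly) \<Rightarrow> bool" where
  "comparison_map I K C \<alpha> \<longleftrightarrow>
     (\<forall>i. \<forall>r\<in>basis C i. \<forall>c\<in>basis K i. graded_entry (shift K i c) (shift C i r) (\<alpha> i r c)) \<and>
     (\<forall>b\<in>basis C 0. \<forall>c\<in>basis K 0. \<alpha> 0 b c - 1 \<in> I) \<and>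
     (\<forall>i. \<forall>r\<in>basis C i. \<forall>c\<in>basis K (Suc i).
        (\<Sum>s\<in>basis C (Suc i). diff C (Suc i) r s * \<alpha> (Suc i) s c) =
        (\<Sum>s\<in>basis K i. \<alpha> i r s * diff K (Suc i) s c))"

text \<open>\<open>(K\<^sub>i \<otimes>\<^sub>R k)\<^sub>t\<close> and \<open>(C\<^sub>i \<otimes>\<^sub>R k)\<^sub>t\<close> have bases \<open>copies K i t\<close> and \<open>copies C i t\<close>,
  and the induced map has the constant coefficients of the \<open>\<alpha> i r c\<close> as matrix.\<close>

definition induced_surj ::
  "('c, ('n, 'k::field) mpoly) graded_seq \<Rightarrow> ('b, ('n, 'k) mpoly) graded_seq
     \<Rightarrow> (nat \<Rightarrow> 'b \<Rightarrow> 'c \<Rightarrow> ('n, 'k) mpoly) \<Rightarrow> nat \<Rightarrow> nat \<Rightarrow> bool" where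
  "induced_surj K C \<alpha> i t \<longleftrightarrow>
     (\<forall>v :: 'b \<Rightarrow> 'k. \<exists>u :: 'c \<Rightarrow> 'k. \<forall>r\<in>copies C i t.
        mat_app (copies K i t) (\<lambda>r c. Poly_Mapping.lookup (\<alpha> i r c) 0) u r = v r)"

text \<open>Comparison maps from the Koszul complex to a resolution exist and all of them
  induce the same map, so one may ask for surjectivity of the map induced by some of them.\<close>

definition koszul_copies ::
  "nat \<Rightarrow> (nat \<Rightarrow> nat) \<Rightarrow> (nat \<Rightarrow> ('n, 'k::field) mpoly) \<Rightarrow> ('b, ('n, 'k) mpoly) graded_seq
     \<Rightarrow> nat \<Rightarrow> nat \<Rightarrow> bool" where
  "koszul_copies N e F C i t \<longleftrightarrow>
     (\<exists>\<alpha>. comparison_map (ideal_gen (F ` {1..N})) (koszul N e F) C \<alpha> \<and>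
          induced_surj (koszul N e F) C \<alpha> i t)"

definition non_koszul_ghost_term ::
  "nat \<Rightarrow> (nat \<Rightarrow> nat) \<Rightarrow> (nat \<Rightarrow> ('n, 'k::field) mpoly) \<Rightarrow> ('b, ('n, 'k) mpoly) graded_seq
     \<Rightarrow> nat \<Rightarrow> nat \<Rightarrow> bool" where
  "non_koszul_ghost_term N e F C i t \<longleftrightarrow>
     ghost_term C i t \<and> \<not> koszul_copies N e F C (Suc i) t"

end

theory Submission
  imports Defs "Jordan_Normal_Form.Determinant"
begin

text \<open>All conditions on the forms that are needed are of the form that a square family of vectors
  with polynomial coordinates spans; by determinants it is enough that they hold at one point:
  \<open>F\<^sub>i = x\<^sub>i\<^bsup>d\<^sub>i\<^esup>\<close> for \<open>i \<le> n\<close> and, with \<open>\<beta> = (d\<^sub>1 - 1, \<dots>, d\<^sub>n - 1)\<close> and \<open>s = |\<beta>| = d - n\<close>,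
  \<open>F\<^sub>n\<^sub>+\<^sub>j = x\<^bsup>\<beta>\<^esup> / x\<^sub>j\<close> for \<open>j \<le> n - 2\<close>.

  If the reduced monomials span \<open>R/J\<close> up to degree \<open>s + 1\<close>, then the products
  \<open>F\<^sub>1\<^bsup>a\<^sub>1\<^esup> \<cdots> F\<^sub>n\<^bsup>a\<^sub>n\<^esup> x\<^bsup>b\<^esup>\<close>, \<open>b \<le> \<beta>\<close>, span \<open>R\<close>; as \<open>(a, b) \<mapsto> (a\<^sub>i d\<^sub>i + b\<^sub>i)\<close> is a bijection onto the
  exponents, they are a basis. Hence \<open>F\<^sub>1, \<dots>, F\<^sub>n\<close> is regular, and the coefficient of \<open>x\<^bsup>\<beta>\<^esup>\<close> is a
  residue functional \<open>R\<^sub>s \<rightarrow> k\<close> that vanishes on \<open>J\<close>. By duality, the general forms of degree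
  \<open>s - 1\<close> leave a two-dimensional space of linear forms \<open>W = (w\<^sub>1, w\<^sub>2)\<close>; a quadric functional
  that kills \<open>R\<^sub>1 W\<close> yields a socle element of \<open>R/I\<close> in degree \<open>s - 2\<close>, and the Koszul relation
  \<open>w\<^sub>1 w\<^sub>2 = w\<^sub>2 w\<^sub>1\<close> a nonzero class in \<open>Ext\<^sup>1(k, R/I)\<close>. These are the two terms \<open>R(-d + 2)\<close>. No
  \<open>n\<close> of the degrees of the generators add up to \<open>d - 2\<close>, so no Koszul syzygy contributes.\<close>


section \<open>Square linear systems\<close>

text \<open>Invertibility of the \<open>S\<close>-by-\<open>S\<close> matrix \<open>A\<close>,
  phrased as solvability so that \<open>S\<close> needs no enumeration.\<close>

definition spans_on :: "'s set \<Rightarrow> ('s \<Rightarrow> 's \<Rightarrow> 'k::field) \<Rightarrow> bool" where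
  "spans_on S A \<longleftrightarrow> (\<forall>y. \<exists>x. \<forall>s\<in>S. (\<Sum>j\<in>S. A s j * x j) = y s)"

text \<open>Solutions for the unit vectors are the columns of a right inverse, so the determinant is
  a unit; conversely an inverse matrix produces the solutions. Spanning thus becomes the
  nonvanishing of one polynomial in the entries.\<close>

lemma spans_on_iff_det:
  fixes A :: "'s \<Rightarrow> 's \<Rightarrow> 'k::field"
  assumes h: "bij_betw h {0..<N} S"
  shows "spans_on S A \<longleftrightarrow> Determinant.det (mat N N (\<lambda>(i, j). A (h i) (h j))) \<noteq> 0"
proof
  let ?M = "mat N N (\<lambda>(i, j). A (h i) (h j))"
  define g where "g = the_inv_into {0..<N} h"
  have gh: "g (h i) = i" if "i < N" for i
    unfolding g_def using h that by (auto simp: bij_betw_def intro: the_inv_into_f_f)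
  have re: "(\<Sum>j\<in>S. c j) = (\<Sum>j = 0..<N. c (h j))" for c :: "'s \<Rightarrow> 'k"
    using sum.reindex_bij_betw[OF h, of c] by simp
  have S: "s \<in> S \<longleftrightarrow> (\<exists>i<N. s = h i)" for s
    using h by (auto simp: bij_betw_def)
  {
    assume sp: "spans_on S A"
    have "\<forall>j. \<exists>x. \<forall>s\<in>S. (\<Sum>l\<in>S. A s l * x l) = (if s = h j then 1 else 0)"
      using sp by (auto simp: spans_on_def)
    then obtain X where X: "\<And>j s. s \<in> S \<Longrightarrow> (\<Sum>l\<in>S. A s l * X j l) = (if s = h j then 1 else 0)"
      by metis
    let ?B = "mat N N (\<lambda>(i, j). X j (h i))"
    have "?M * ?B = 1\<^sub>m N"
    proof (rule eq_matI)
      fix i j assume ij: "i < dim_row (1\<^sub>m N :: 'k mat)" "j < dim_col (1\<^sub>m N :: 'k mat)"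
      then have "(?M * ?B) $$ (i, j) = (\<Sum>l\<in>S. A (h i) l * X j l)"
        by (simp add: scalar_prod_def re)
      also have "\<dots> = (if h i = h j then 1 else 0)"
        using X[of "h i" j] ij S[of "h i"] by (metis index_one_mat(2))
      also have "\<dots> = 1\<^sub>m N $$ (i, j)"
        using ij gh by (metis index_one_mat(1) index_one_mat(2) index_one_mat(3))
      finally show "(?M * ?B) $$ (i, j) = 1\<^sub>m N $$ (i, j)" .
    qed simp_all
    then have "Determinant.det ?M * Determinant.det ?B = 1"
      by (metis det_mult det_one mat_carrier)
    then show "Determinant.det ?M \<noteq> 0" by auto
  }
  {
    assume "Determinant.det ?M \<noteq> 0"
    from det_non_zero_imp_unit[OF _ this, of N undefined]
    obtain B where B: "B \<in> carrier_mat N N" "?M * B = 1\<^sub>m N"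
      by (auto simp: Units_def ring_mat_def)
    show "spans_on S A"
      unfolding spans_on_def
    proof (intro allI)
      fix y :: "'s \<Rightarrow> 'k"
      let ?y = "vec N (\<lambda>i. y (h i))"
      let ?x = "B *\<^sub>v ?y"
      have x: "?M *\<^sub>v ?x = ?y"
        using B by (metis assoc_mult_mat_vec mat_carrier one_mult_mat_vec vec_carrier)
      have "(\<Sum>j\<in>S. A (h i) j * (?x $ g j)) = y (h i)" if i: "i < N" for i
      proof -
        have "(\<Sum>j\<in>S. A (h i) j * (?x $ g j)) = (?M *\<^sub>v ?x) $ i"
          using i B(1) by (simp add: re scalar_prod_def gh del: index_mult_mat_vec assoc_mult_mat_vec) 
            (simp add: scalar_prod_def gh)
        also have "\<dots> = y (h i)"
          unfolding x using i by simp
        finally show ?thesis .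
      qed
      then show "\<exists>x. \<forall>s\<in>S. (\<Sum>j\<in>S. A s j * x j) = y s"
        using S by (intro exI[of _ "\<lambda>j. ?x $ g j"]) auto
    qed
  }
qed

text \<open>For a square matrix surjectivity gives a nonzero determinant and hence a trivial
  kernel.\<close>

lemma spans_on_inj:
  fixes A :: "'s \<Rightarrow> 's \<Rightarrow> 'k::field"
  assumes fin: "finite S" and sp: "spans_on S A"
    and x: "\<And>s. s \<in> S \<Longrightarrow> (\<Sum>j\<in>S. A s j * x j) = 0" and s: "s \<in> S"
  shows "x s = 0"
proof -
  define N where "N = card S"
  obtain h where h: "bij_betw h {0..<N} S"
    using ex_bij_betw_nat_finite[OF fin] unfolding N_def by blast
  let ?M = "mat N N (\<lambda>(i, j). A (h i) (h j))"
  let ?v = "vec N (\<lambda>i. x (h i))"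
  have "Determinant.det ?M \<noteq> 0"
    using sp spans_on_iff_det[OF h] by blast
  moreover have "?M *\<^sub>v ?v = 0\<^sub>v N"
  proof (rule eq_vecI)
    fix i assume i: "i < dim_vec (0\<^sub>v N :: 'k vec)"
    then have "(?M *\<^sub>v ?v) $ i = (\<Sum>j\<in>S. A (h i) j * x j)"
      by (simp add: scalar_prod_def sum.reindex_bij_betw[OF h, of "\<lambda>j. A (h i) j * x j", symmetric])
    also have "\<dots> = 0"
      using x h i by (auto simp: bij_betw_def)
    finally show "(?M *\<^sub>v ?v) $ i = 0\<^sub>v N $ i"
      using i by simp
  qed simp
  ultimately have "?v = 0\<^sub>v N"
    using det_0_iff_vec_prod_zero_field[of ?M N] by (metis mat_carrier vec_carrier)
  moreover obtain i where "i < N" "s = h i"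
    using s h by (auto simp: bij_betw_def)
  ultimately show ?thesis
    by (metis index_vec index_zero_vec(1))
qed

text \<open>Gaussian elimination: a nonzero coefficient removes one equation and one unknown; when
  all coefficients vanish, every vector is a solution.\<close>

lemma homogeneous_system_solution:
  fixes a :: "'e \<Rightarrow> 'u \<Rightarrow> 'k::field"
  assumes "finite E" "finite U" "card E < card U"
  shows "\<exists>x. (\<exists>u\<in>U. x u \<noteq> 0) \<and> (\<forall>e\<in>E. (\<Sum>u\<in>U. a e u * x u) = 0)"
  using assms
proof (induction "card E" arbitrary: E U a rule: less_induct)
  case less
  show ?case
  proof (cases "\<exists>e\<in>E. \<exists>u\<in>U. a e u \<noteq> 0")
    case False
    moreover have "U \<noteq> {}" using less.prems by auto
    ultimately show ?thesis
      by (intro exI[of _ "\<lambda>_. 1"]) auto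
  next
    case True
    then obtain e0 u0 where eu: "e0 \<in> E" "u0 \<in> U" "a e0 u0 \<noteq> 0" by blast
    let ?E = "E - {e0}" and ?U = "U - {u0}"
    \<comment> \<open>Row \<open>e\<close> minus the multiple of the pivot row \<open>e0\<close>
      that cancels the unknown \<open>u0\<close>.\<close>
    define a' where "a' e u = a e u - a e u0 * a e0 u / a e0 u0" for e u
    have "card ?E < card E" "card ?E < card ?U"
      using eu less.prems card_gt_0_iff[of E] by (auto simp: diff_less_mono)
    then obtain x where x: "\<exists>u\<in>?U. x u \<noteq> 0" "\<And>e. e \<in> ?E \<Longrightarrow> (\<Sum>u\<in>?U. a' e u * x u) = 0"
      using less.hyps[of ?E ?U a'] less.prems by auto
    \<comment> \<open>The value of the unknown \<open>u0\<close> that the pivot equation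
      forces.\<close>
    define t where "t = - (\<Sum>u\<in>?U. a e0 u * x u) / a e0 u0"
    define x' where "x' = x(u0 := t)"
    have split: "(\<Sum>u\<in>U. a e u * x' u) = a e u0 * t + (\<Sum>u\<in>?U. a e u * x u)" for e
      unfolding x'_def using less.prems(2) eu(2)
      by (subst sum.remove[of U u0]) (auto intro!: sum.cong)
    have "(\<Sum>u\<in>U. a e u * x' u) = 0" if e: "e \<in> E" for e
    proof (cases "e = e0")
      case True
      then show ?thesis unfolding split t_def using eu by simp
    next
      case False
      then have "0 = (\<Sum>u\<in>?U. a' e u * x u)" using x e by simp
      also have "\<dots> = (\<Sum>u\<in>?U. a e u * x u) - a e u0 / a e0 u0 * (\<Sum>u\<in>?U. a e0 u * x u)"
        unfolding a'_def by (simp add: sum_distrib_left left_diff_distrib sum_subtractf algebra_simps)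
      also have "\<dots> = (\<Sum>u\<in>U. a e u * x' u)"
        unfolding split t_def by simp
      finally show ?thesis by simp
    qed
    moreover have "\<exists>u\<in>U. x' u \<noteq> 0"
      using x(1) unfolding x'_def by auto
    ultimately show ?thesis by blast
  qed
qed


section \<open>Monomials and forms\<close>

abbreviation "lookup \<equiv> Poly_Mapping.lookup"
abbreviation "keys \<equiv> Poly_Mapping.keys"

definition mon :: "('n \<Rightarrow>\<^sub>0 nat) \<Rightarrow> ('n, 'k::zero_neq_one) mpoly" where
  "mon m = Poly_Mapping.single m 1"

definition cst :: "'k \<Rightarrow> ('n, 'k::zero) mpoly" where
  "cst c = Poly_Mapping.single 0 c"

lemma cst_simps [simp]:
  "cst 0 = 0" "cst 1 = (1 :: ('n, 'k::comm_ring_1) mpoly)"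
  by (simp_all add: cst_def)

lemma cst_hom:
  fixes a b :: "'k::comm_ring_1"
  shows "(cst (a + b) :: ('n, 'k) mpoly) = cst a + cst b"
    "(cst (a - b) :: ('n, 'k) mpoly) = cst a - cst b"
    "(cst (a * b) :: ('n, 'k) mpoly) = cst a * cst b"
    "(cst (- a) :: ('n, 'k) mpoly) = - cst a"
  by (simp_all add: cst_def single_add single_diff mult_single single_uminus)

lemma mon_0 [simp]: "mon 0 = (1 :: ('n, 'k::comm_ring_1) mpoly)"
  by (simp add: mon_def)

lemma mon_add: "mon (a + b) = (mon a * mon b :: ('n, 'k::comm_ring_1) mpoly)"
  by (simp add: mon_def mult_single)

lemma cst_mon: "cst c * mon m = (Poly_Mapping.single m c :: ('n, 'k::comm_ring_1) mpoly)"
  by (simp add: mon_def cst_def mult_single)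

lemma lookup_mon: "lookup (mon m :: ('n, 'k::zero_neq_one) mpoly) m' = (if m = m' then 1 else 0)"
  by (simp add: mon_def lookup_single when_def)

lemma keys_mon [simp]: "keys (mon m :: ('n, 'k::zero_neq_one) mpoly) = {m}"
  by (simp add: mon_def)

lemma lookup_cst_mult [simp]:
  "lookup (cst c * p :: ('n, 'k::comm_ring_1) mpoly) m = c * lookup p m"
  unfolding cst_def mult_map_scale_conv_mult[symmetric]
  by (simp add: Poly_Mapping.map.rep_eq when_def)

lemma lookup_mon_mult_add [simp]:
  "lookup (mon a * p :: ('n, 'k::comm_ring_1) mpoly) (a + m) = lookup p m"
proof -
  have "(\<lambda>l. lookup (mon a :: ('n, 'k) mpoly) l * Sum_any (\<lambda>q. lookup p q when a + m = l + q)) =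
      (\<lambda>l. Sum_any (\<lambda>q. lookup p q when m = q) when l = a)"
    by (auto simp: fun_eq_iff lookup_mon when_def)
  then have "lookup (mon a * p) (a + m) = Sum_any (\<lambda>l. Sum_any (\<lambda>q. lookup p q when m = q) when l = a)"
    unfolding lookup_mult by (rule arg_cong)
  then show ?thesis
    by simp
qed

lemma lookup_mon_mult_0:
  "(\<And>m'. m \<noteq> a + m') \<Longrightarrow> lookup (mon a * p :: ('n, 'k::comm_ring_1) mpoly) m = 0"
  using keys_mult[of "mon a" p] by (force simp: in_keys_iff)

lemma mpoly_expand:
  fixes p :: "('n, 'k::comm_ring_1) mpoly"
  assumes "finite A" "keys p \<subseteq> A"
  shows "p = (\<Sum>m\<in>A. cst (lookup p m) * mon m)"
proof (rule poly_mapping_eqI)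
  fix m
  have "lookup (\<Sum>m\<in>A. cst (lookup p m) * mon m) m = (\<Sum>m'\<in>A. if m' = m then lookup p m' else 0)"
    unfolding lookup_sum by (intro sum.cong) (auto simp: lookup_mon)
  also have "\<dots> = lookup p m"
    using assms by (auto simp: sum.delta in_keys_iff)
  finally show "lookup p m = lookup (\<Sum>m\<in>A. cst (lookup p m) * mon m) m" by simp
qed

lemma mdeg_UNIV: "mdeg (m :: 'n::finite \<Rightarrow>\<^sub>0 nat) = (\<Sum>v\<in>UNIV. lookup m v)"
  unfolding mdeg_def by (rule sum.mono_neutral_left) (auto simp: in_keys_iff)

lemma mdeg_add: "mdeg (a + b) = mdeg a + mdeg (b :: 'n::finite \<Rightarrow>\<^sub>0 nat)"
  by (simp add: mdeg_UNIV lookup_add sum.distrib)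

lemma mdeg_0 [simp]: "mdeg 0 = 0"
  by (simp add: mdeg_def)

lemma mdeg_single [simp]: "mdeg (Poly_Mapping.single v k) = k"
  by (simp add: mdeg_def)

definition mons :: "nat \<Rightarrow> ('n \<Rightarrow>\<^sub>0 nat) set" where
  "mons t = {m. mdeg m = t}"

lemma finite_mons [simp]: "finite (mons t :: ('n::finite \<Rightarrow>\<^sub>0 nat) set)"
proof -
  have "lookup m v \<le> mdeg m" for m :: "'n \<Rightarrow>\<^sub>0 nat" and v
    unfolding mdeg_UNIV by (rule member_le_sum) simp_all
  then have "lookup ` (mons t :: ('n \<Rightarrow>\<^sub>0 nat) set) \<subseteq> (\<Pi>\<^sub>E v\<in>UNIV. {..t})"
    unfolding mons_def by blast
  then have "finite (lookup ` (mons t :: ('n \<Rightarrow>\<^sub>0 nat) set))"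
    by (rule finite_subset) (simp add: finite_PiE)
  then show ?thesis
    by (rule finite_imageD) (simp add: inj_on_def lookup_inject)
qed

definition expo :: "('n::finite \<Rightarrow> nat) \<Rightarrow> ('n \<Rightarrow>\<^sub>0 nat)" where
  "expo f = Abs_poly_mapping f"

lemma lookup_expo [simp]: "lookup (expo f) v = f v"
  by (simp add: expo_def)

lemma mdeg_expo: "mdeg (expo f) = (\<Sum>v\<in>UNIV. f v)"
  by (simp add: mdeg_UNIV)

lemma exponent_diff:
  fixes a m :: "'n \<Rightarrow>\<^sub>0 nat"
  assumes "\<And>v. lookup a v \<le> lookup m v"
  shows "a + (m - a) = m"
  using assms by (intro poly_mapping_eqI) (simp add: lookup_add lookup_minus)

lemma exponent_diff_single:
  fixes m :: "'n \<Rightarrow>\<^sub>0 nat"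
  assumes "d \<le> lookup m v"
  shows "Poly_Mapping.single v d + (m - Poly_Mapping.single v d) = m"
  by (rule exponent_diff) (use assms in \<open>auto simp: lookup_single when_def\<close>)

text \<open>The divisor takes over one variable of the cofactor per step. It serves to reduce
  monomials of high degree through a divisor of a fixed degree.\<close>

lemma exponent_below:
  fixes m :: "'n::finite \<Rightarrow>\<^sub>0 nat"
  assumes "t \<le> mdeg m"
  shows "\<exists>a b. m = a + b \<and> mdeg a = t"
  using assms
proof (induction t)
  case 0
  show ?case by (rule exI[of _ 0]) simp
next
  case (Suc t)
  then obtain a b where ab: "m = a + b" "mdeg a = t" by auto
  then have "mdeg b \<noteq> 0" using Suc.prems by (simp add: mdeg_add)
  then obtain v where v: "lookup b v > 0" by (auto simp: mdeg_UNIV)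
  let ?s = "Poly_Mapping.single v (1::nat)"
  have "?s + (b - ?s) = b"
    by (rule exponent_diff_single) (use v in linarith)
  then have m: "m = (a + ?s) + (b - ?s)"
    unfolding ab(1) add.assoc by (rule arg_cong[OF sym])
  show ?case
  proof -
    have "mdeg (a + ?s) = Suc t" unfolding mdeg_add mdeg_single ab(2) by (rule Suc_eq_plus1[symmetric])
    with m show ?thesis by blast
  qed
qed

lemma forms_iff: "p \<in> forms t \<longleftrightarrow> keys p \<subseteq> mons t"
  by (auto simp: forms_def mons_def)

lemma forms_0 [simp]: "0 \<in> forms t"
  by (simp add: forms_def)

lemma forms_add: "p \<in> forms t \<Longrightarrow> q \<in> forms t \<Longrightarrow> p + q \<in> forms t"
  using keys_add[of p q] by (auto simp: forms_iff)

lemma forms_uminus: "p \<in> forms t \<Longrightarrow> - p \<in> forms t" for p :: "('n, 'k::comm_ring_1) mpoly"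
  by (auto simp: forms_def in_keys_iff)

lemma forms_sum: "(\<And>i. i \<in> A \<Longrightarrow> f i \<in> forms t) \<Longrightarrow> (\<Sum>i\<in>A. f i) \<in> forms t"
  by (induction A rule: infinite_finite_induct) (auto intro: forms_add)

lemma forms_mult:
  fixes p q :: "('n::finite, 'k::comm_ring_1) mpoly"
  shows "p \<in> forms s \<Longrightarrow> q \<in> forms t \<Longrightarrow> p * q \<in> forms (s + t)"
  using keys_mult[of p q] by (force simp: forms_def mdeg_add)

lemma forms_cst: "(cst c :: ('n, 'k::zero) mpoly) \<in> forms 0"
  by (simp add: forms_def cst_def)

lemma forms_cst_mult: "p \<in> forms t \<Longrightarrow> cst c * p \<in> forms t"
  for p :: "('n::finite, 'k::comm_ring_1) mpoly"
  using forms_mult[OF forms_cst] by (metis add_0)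

lemma forms_mon: "mdeg m = t \<Longrightarrow> (mon m :: ('n, 'k::zero_neq_one) mpoly) \<in> forms t"
  by (simp add: forms_def)

lemma forms_1: "(1 :: ('n, 'k::comm_ring_1) mpoly) \<in> forms 0"
  by (simp add: forms_def)

lemma forms_power: "p \<in> forms t \<Longrightarrow> p ^ k \<in> forms (k * t)"
  for p :: "('n::finite, 'k::comm_ring_1) mpoly"
  by (induction k) (auto intro: forms_1 forms_mult)

lemma forms_prod:
  fixes f :: "'i \<Rightarrow> ('n::finite, 'k::comm_ring_1) mpoly"
  shows "(\<And>i. i \<in> A \<Longrightarrow> f i \<in> forms (t i)) \<Longrightarrow> (\<Prod>i\<in>A. f i) \<in> forms (\<Sum>i\<in>A. t i)"
  by (induction A rule: infinite_finite_induct) (auto intro: forms_1 forms_mult)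

lemma forms_expand: "p \<in> forms t \<Longrightarrow> p = (\<Sum>m\<in>mons t. cst (lookup p m) * mon m)"
  for p :: "('n::finite, 'k::comm_ring_1) mpoly"
  by (rule mpoly_expand) (auto simp: forms_iff)

abbreviation var :: "'n \<Rightarrow> ('n, 'k::zero_neq_one) mpoly" where
  "var v \<equiv> mon (Poly_Mapping.single v 1)"

lemma forms_var: "(var v :: ('n, 'k::zero_neq_one) mpoly) \<in> forms 1"
  by (simp add: forms_def)


section \<open>Conditions that hold near a given tuple of forms\<close>

definition mon_eval :: "('v \<Rightarrow>\<^sub>0 nat) \<Rightarrow> ('v \<Rightarrow> 'k) \<Rightarrow> 'k::comm_semiring_1" where
  "mon_eval m x = (\<Prod>v\<in>keys m. x v ^ lookup m v)"

lemma mon_eval_superset: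
  assumes "finite A" "keys m \<subseteq> A"
  shows "mon_eval m x = (\<Prod>v\<in>A. x v ^ lookup m v)"
  unfolding mon_eval_def using assms by (intro prod.mono_neutral_left) (auto simp: in_keys_iff)

lemma mon_eval_add: "mon_eval (a + b) x = mon_eval a x * mon_eval b x"
proof -
  have "keys (a + b) \<subseteq> keys a \<union> keys b" by (rule keys_add)
  then show ?thesis
    by (simp add: mon_eval_superset[of "keys a \<union> keys b"] lookup_add power_add prod.distrib)
qed

lemma eval_poly_superset:
  assumes "finite A" "keys P \<subseteq> A"
  shows "eval_poly P x = (\<Sum>m\<in>A. lookup P m * mon_eval m x)"
  unfolding eval_poly_def mon_eval_def
  using assms by (intro sum.mono_neutral_left) (auto simp: in_keys_iff)

lemma eval_poly_add: "eval_poly (P + Q) x = eval_poly P x + eval_poly Q x"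
proof -
  have "keys (P + Q) \<subseteq> keys P \<union> keys Q" by (rule keys_add)
  then show ?thesis
    by (simp add: eval_poly_superset[of "keys P \<union> keys Q"] lookup_add distrib_right sum.distrib)
qed

lemma eval_poly_single: "eval_poly (Poly_Mapping.single m c) x = c * mon_eval m x"
  by (cases "c = 0") (simp_all add: eval_poly_def mon_eval_def)

lemma eval_poly_sum: "eval_poly (\<Sum>i\<in>A. P i) x = (\<Sum>i\<in>A. eval_poly (P i) x)"
  by (induction A rule: infinite_finite_induct) (simp_all add: eval_poly_add eval_poly_def[of 0])

lemma eval_poly_mult:
  fixes P Q :: "('v, 'k::comm_ring_1) mpoly"
  shows "eval_poly (P * Q) x = eval_poly P x * eval_poly Q x"
proof -
  have expand: "P = (\<Sum>m\<in>keys P. Poly_Mapping.single m (lookup P m))" for P :: "('v, 'k) mpoly"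
    using mpoly_expand[of "keys P" P] by (simp add: cst_mon)
  have "P * Q = (\<Sum>a\<in>keys P. \<Sum>b\<in>keys Q. Poly_Mapping.single (a + b) (lookup P a * lookup Q b))"
    by (subst expand[of P], subst expand[of Q]) (simp add: sum_product mult_single)
  then have "eval_poly (P * Q) x =
      (\<Sum>a\<in>keys P. \<Sum>b\<in>keys Q. (lookup P a * mon_eval a x) * (lookup Q b * mon_eval b x))"
    by (simp add: eval_poly_sum eval_poly_single mon_eval_add mult_ac)
  also have "\<dots> = eval_poly P x * eval_poly Q x"
    by (simp add: eval_poly_superset[of "keys P" P] eval_poly_superset[of "keys Q" Q] sum_product)
  finally show ?thesis .
qed

text \<open>The identity is required for all families \<open>F\<close>, not only for tuples of
  forms, so closure under ring operations carries no side conditions.\<close>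

definition poly_fun :: "((nat \<Rightarrow> ('n, 'k::field) mpoly) \<Rightarrow> 'k) \<Rightarrow> bool" where
  "poly_fun g \<longleftrightarrow> (\<exists>P. \<forall>F. g F = eval_poly P (\<lambda>(i, m). lookup (F i) m))"

lemma poly_fun_const: "poly_fun (\<lambda>_. c)"
  unfolding poly_fun_def
  by (rule exI[of _ "Poly_Mapping.single 0 c"]) (simp add: eval_poly_single mon_eval_def)

lemma poly_fun_coord: "poly_fun (\<lambda>F. lookup (F i) m)"
  unfolding poly_fun_def
  by (rule exI[of _ "Poly_Mapping.single (Poly_Mapping.single (i, m) 1) 1"])
    (simp add: eval_poly_single mon_eval_def)

lemma poly_fun_add: "poly_fun f \<Longrightarrow> poly_fun g \<Longrightarrow> poly_fun (\<lambda>F. f F + g F)"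
  unfolding poly_fun_def by (metis eval_poly_add)

lemma poly_fun_mult: "poly_fun f \<Longrightarrow> poly_fun g \<Longrightarrow> poly_fun (\<lambda>F. f F * g F)"
  unfolding poly_fun_def by (metis eval_poly_mult)

lemma poly_fun_sum: "(\<And>i. i \<in> A \<Longrightarrow> poly_fun (f i)) \<Longrightarrow> poly_fun (\<lambda>F. \<Sum>i\<in>A. f i F)"
  by (induction A rule: infinite_finite_induct) (auto intro: poly_fun_add poly_fun_const)

lemma poly_fun_prod: "(\<And>i. i \<in> A \<Longrightarrow> poly_fun (f i)) \<Longrightarrow> poly_fun (\<lambda>F. \<Prod>i\<in>A. f i F)"
  by (induction A rule: infinite_finite_induct) (auto intro: poly_fun_mult poly_fun_const)

text \<open>The Leibniz expansion is a polynomial in the entries.\<close>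

lemma poly_fun_det:
  assumes "\<And>i j. poly_fun (\<lambda>F. A F i j)"
  shows "poly_fun (\<lambda>F. Determinant.det (mat N N (\<lambda>(i, j). A F i j)))"
proof -
  have "Determinant.det (mat N N (\<lambda>(i, j). A F i j)) =
      (\<Sum>p\<in>{p. p permutes {0..<N}}. signof p * (\<Prod>i\<in>{0..<N}. A F i (p i)))" for F
    by (auto simp: det_def'[of _ N] permutes_in_image intro!: sum.cong prod.cong)
  then show ?thesis
    by (simp only:) (intro poly_fun_sum poly_fun_mult poly_fun_const poly_fun_prod assms)
qed

text \<open>\<open>Q\<close> holds on a principal open set around \<open>F0\<close>. Since all these
  sets share the point \<open>F0\<close>, finite intersections of them stay nonempty.\<close>

definition open_near ::
  "nat \<Rightarrow> (nat \<Rightarrow> nat) \<Rightarrow> (nat \<Rightarrow> ('n, 'k::field) mpoly) \<Rightarrow> ((nat \<Rightarrow> ('n, 'k) mpoly) \<Rightarrow> bool) \<Rightarrow> bool" where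
  "open_near N e F0 Q \<longleftrightarrow>
     (\<exists>g. poly_fun g \<and> g F0 \<noteq> 0 \<and> (\<forall>F\<in>form_tuples N e. g F \<noteq> 0 \<longrightarrow> Q F))"

lemma open_near_mono:
  "open_near N e F0 Q \<Longrightarrow> (\<And>F. F \<in> form_tuples N e \<Longrightarrow> Q F \<Longrightarrow> Q' F) \<Longrightarrow> open_near N e F0 Q'"
  unfolding open_near_def by blast

lemma open_near_True: "open_near N e F0 (\<lambda>_. True)"
  unfolding open_near_def by (rule exI[of _ "\<lambda>_. 1"]) (simp add: poly_fun_const)

lemma open_near_conj:
  assumes "open_near N e F0 Q" "open_near N e F0 Q'"
  shows "open_near N e F0 (\<lambda>F. Q F \<and> Q' F)"
proof -
  obtain g g' where "poly_fun g" "g F0 \<noteq> 0" "\<forall>F\<in>form_tuples N e. g F \<noteq> 0 \<longrightarrow> Q F"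
    "poly_fun g'" "g' F0 \<noteq> 0" "\<forall>F\<in>form_tuples N e. g' F \<noteq> 0 \<longrightarrow> Q' F"
    using assms unfolding open_near_def by blast
  then show ?thesis
    unfolding open_near_def by (intro exI[of _ "\<lambda>F. g F * g' F"]) (simp add: poly_fun_mult)
qed

lemma open_near_ball:
  assumes "finite A" "\<And>i. i \<in> A \<Longrightarrow> open_near N e F0 (Q i)"
  shows "open_near N e F0 (\<lambda>F. \<forall>i\<in>A. Q i F)"
  using assms
proof (induction A rule: finite_induct)
  case empty
  then show ?case by (simp add: open_near_True)
next
  case (insert i A)
  then have "open_near N e F0 (\<lambda>F. Q i F \<and> (\<forall>i\<in>A. Q i F))"
    by (intro open_near_conj) simp_all
  then show ?case by simp
qed

lemma open_near_imp_general:
  fixes F0 :: "nat \<Rightarrow> ('n, 'k::field) mpoly"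
  assumes "open_near N e F0 Q" "F0 \<in> form_tuples N e"
  shows "for_general_forms N e Q"
proof -
  obtain g where g: "poly_fun g" "g F0 \<noteq> 0" "\<forall>F\<in>form_tuples N e. g F \<noteq> 0 \<longrightarrow> Q F"
    using assms(1) unfolding open_near_def by blast
  obtain P where P: "\<And>F. g F = eval_poly P (\<lambda>(i, m). lookup (F i) m)"
    using g(1) unfolding poly_fun_def by blast
  let ?U = "{F \<in> form_tuples N e. \<exists>P\<in>{P}. eval_poly P (\<lambda>(i, m). lookup (F i) m) \<noteq> 0}"
  have "zariski_open N e ?U"
    unfolding zariski_open_def by blast
  moreover have "F0 \<in> ?U" "\<forall>F\<in>?U. Q F"
    using assms(2) g(2,3) P by auto
  ultimately show ?thesis
    unfolding for_general_forms_def by blast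
qed

text \<open>The determinant of the system is the polynomial function that does not vanish at
  \<open>F0\<close>.\<close>

lemma open_near_spans_on:
  assumes "finite S" "\<And>i j. poly_fun (\<lambda>F. A F i j)" "spans_on S (A F0)"
  shows "open_near N e F0 (\<lambda>F. spans_on S (A F))"
proof -
  obtain h where h: "bij_betw h {0..<card S} S"
    using ex_bij_betw_nat_finite[OF assms(1)] by blast
  have "poly_fun (\<lambda>F. Determinant.det (mat (card S) (card S) (\<lambda>(i, j). A F (h i) (h j))))"
    by (rule poly_fun_det) (rule assms(2))
  then show ?thesis
    unfolding open_near_def using assms(3) spans_on_iff_det[OF h] by blast
qed


section \<open>Polynomials as a free module over the subring of a full system of forms\<close>

lemma module_mult: "Modules.module ((*) :: 'a::comm_ring_1 \<Rightarrow> 'a \<Rightarrow> 'a)"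
  by (rule Modules.module.intro) (simp_all add: distrib_left distrib_right mult.assoc)

lemma ideal_gen_gen: "x \<in> S \<Longrightarrow> x \<in> ideal_gen S"
  unfolding ideal_gen_def by (rule Modules.module.span_base[OF module_mult])

lemma ideal_gen_0: "0 \<in> ideal_gen S"
  unfolding ideal_gen_def by (rule Modules.module.span_zero[OF module_mult])

lemma ideal_gen_mult: "x \<in> ideal_gen S \<Longrightarrow> c * x \<in> ideal_gen S"
  unfolding ideal_gen_def by (rule Modules.module.span_scale[OF module_mult])

lemma ideal_gen_sum: "(\<And>i. i \<in> A \<Longrightarrow> g i \<in> ideal_gen S) \<Longrightarrow> (\<Sum>i\<in>A. g i) \<in> ideal_gen S"
  unfolding ideal_gen_def by (rule Modules.module.span_sum[OF module_mult])

lemma ideal_gen_induct [consumes 1, case_names zero step]: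
  assumes "x \<in> ideal_gen S" "P 0" "\<And>c a y. a \<in> S \<Longrightarrow> y \<in> ideal_gen S \<Longrightarrow> P y \<Longrightarrow> P (c * a + y)"
  shows "P x"
proof -
  have "x \<in> ideal_gen S \<and> P x"
    using assms(1) unfolding ideal_gen_def
  proof (induction rule: Modules.module.span_induct_alt[OF module_mult, consumes 1])
    case 1
    show ?case using assms(2) Modules.module.span_zero[OF module_mult] by auto
  next
    case (2 c a y)
    then show ?case
      using assms(3)[of a y c] Modules.module.span_add[OF module_mult] Modules.module.span_scale[OF module_mult]
        Modules.module.span_base[OF module_mult] unfolding ideal_gen_def by metis
  qed
  then show ?thesis ..
qed

section \<open>Reduced monomials and the substitution map\<close>

definition is_reduced :: "('n \<Rightarrow> nat) \<Rightarrow> ('n \<Rightarrow>\<^sub>0 nat) \<Rightarrow> bool" where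
  "is_reduced D m \<longleftrightarrow> (\<forall>v. lookup m v < D v)"

definition pivot_var :: "('n \<Rightarrow> nat) \<Rightarrow> ('n \<Rightarrow>\<^sub>0 nat) \<Rightarrow> 'n" where
  "pivot_var D m = (SOME v. D v \<le> lookup m v)"

text \<open>One step of the reduction modulo the \<open>f v\<close>; at \<open>f v = x\<^sub>v\<^bsup>D v\<^esup>\<close> this is the monomial \<open>m\<close> itself.\<close>

definition std_form :: "('n \<Rightarrow> ('n, 'k::comm_ring_1) mpoly) \<Rightarrow> ('n \<Rightarrow> nat) \<Rightarrow> ('n \<Rightarrow>\<^sub>0 nat) \<Rightarrow> ('n, 'k) mpoly" where
  "std_form f D m = (if is_reduced D m then mon m
     else mon (m - Poly_Mapping.single (pivot_var D m) (D (pivot_var D m))) * f (pivot_var D m))"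

text \<open>For positive \<open>D\<close>, the exponent of the reduced monomial of highest degree,
  which spans the socle modulo all \<open>x_v ^ D v\<close>.\<close>

definition corner_exp :: "('n::finite \<Rightarrow> nat) \<Rightarrow> ('n \<Rightarrow>\<^sub>0 nat)" where
  "corner_exp D = expo (\<lambda>v. D v - 1)"

locale form_system =
  fixes f :: "'n::finite \<Rightarrow> ('n, 'k::field) mpoly" and D :: "'n \<Rightarrow> nat"
  assumes D_pos: "\<And>v. 0 < D v" and f_forms: "\<And>v. f v \<in> forms (D v)"
begin

abbreviation "reduced \<equiv> is_reduced D"

abbreviation "pivot \<equiv> pivot_var D"

abbreviation "std_vec \<equiv> std_form f D"

text \<open>Division with remainder by \<open>D v\<close> in each variable writes an exponent as
  \<open>a * D + b\<close> with \<open>b\<close> reduced, so the products \<open>f^a x^b\<close> are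
  indexed by all monomials.\<close>

definition f_mon :: "('n \<Rightarrow>\<^sub>0 nat) \<Rightarrow> ('n, 'k) mpoly" where
  "f_mon m = (\<Prod>v\<in>UNIV. f v ^ (lookup m v div D v)) * mon (expo (\<lambda>v. lookup m v mod D v))"

text \<open>The linear map from \<open>x^m\<close> to \<open>f_mon m\<close>. Its bijectivity says
  that the polynomial ring is free over the subring of the \<open>f v\<close> with the reduced
  monomials as basis.\<close>

definition subst_f :: "('n, 'k) mpoly \<Rightarrow> ('n, 'k) mpoly" where
  "subst_f h = (\<Sum>m\<in>keys h. cst (lookup h m) * f_mon m)"

lemma subst_f_superset:
  assumes "finite A" "keys h \<subseteq> A"
  shows "subst_f h = (\<Sum>m\<in>A. cst (lookup h m) * f_mon m)"
  unfolding subst_f_def using assms by (intro sum.mono_neutral_left) (auto simp: in_keys_iff)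

lemma subst_f_add: "subst_f (g + h) = subst_f g + subst_f h"
proof -
  have "keys (g + h) \<subseteq> keys g \<union> keys h" by (rule keys_add)
  then show ?thesis
    by (simp add: subst_f_superset[of "keys g \<union> keys h"] lookup_add cst_hom distrib_right sum.distrib)
qed

lemma subst_f_0 [simp]: "subst_f 0 = 0"
  by (simp add: subst_f_def)

lemma subst_f_sum: "subst_f (\<Sum>i\<in>A. g i) = (\<Sum>i\<in>A. subst_f (g i))"
  by (induction A rule: infinite_finite_induct) (simp_all add: subst_f_add)

lemma subst_f_cst_mult: "subst_f (cst c * h) = cst c * subst_f h"
proof -
  have "keys (cst c * h) \<subseteq> keys h" by (auto simp: in_keys_iff)
  then show ?thesis
    by (simp add: subst_f_superset[of "keys h"] cst_hom sum_distrib_left mult.assoc)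
qed

lemma subst_f_mon [simp]: "subst_f (mon m) = f_mon m"
  by (simp add: subst_f_def lookup_mon)

lemma f_mon_forms: "f_mon m \<in> forms (mdeg m)"
proof -
  have "f_mon m \<in> forms ((\<Sum>v\<in>UNIV. lookup m v div D v * D v) + (\<Sum>v\<in>UNIV. lookup m v mod D v))"
    unfolding f_mon_def
    by (intro forms_mult forms_prod forms_power f_forms forms_mon) (simp add: mdeg_expo)
  then show ?thesis
    by (simp add: mdeg_UNIV sum.distrib[symmetric])
qed

lemma f_mon_reduced: "reduced m \<Longrightarrow> f_mon m = mon m"
proof -
  assume "reduced m"
  then have "expo (\<lambda>v. lookup m v mod D v) = m"
    by (intro poly_mapping_eqI) (simp add: is_reduced_def)
  then show ?thesis
    using \<open>reduced m\<close> by (simp add: f_mon_def is_reduced_def)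
qed

text \<open>Adding \<open>D v\<close> to the exponent of \<open>v\<close> raises its quotient by one
  and leaves all remainders unchanged.\<close>

lemma f_mult_f_mon: "f v * f_mon m = f_mon (Poly_Mapping.single v (D v) + m)"
proof -
  let ?m = "Poly_Mapping.single v (D v) + m"
  have 1: "lookup ?m u mod D u = lookup m u mod D u" for u
    by (simp add: lookup_add lookup_single when_def)
  have 2: "lookup ?m u div D u = (if u = v then Suc (lookup m u div D u) else lookup m u div D u)" for u
    using D_pos[of v] by (simp add: lookup_add lookup_single when_def)
  have "(\<Prod>u\<in>UNIV. f u ^ (lookup ?m u div D u)) = f v * (\<Prod>u\<in>UNIV. f u ^ (lookup m u div D u))"
    unfolding 2 by (subst (1 2) prod.remove[of UNIV v]) (simp_all add: mult.assoc)
  then show ?thesis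
    unfolding f_mon_def 1 by (simp only: mult.assoc)
qed

text \<open>This transports questions about the \<open>f v\<close> to questions about the monomials
  \<open>x_v ^ D v\<close>.\<close>

lemma f_mult_subst_f: "f v * subst_f h = subst_f (mon (Poly_Mapping.single v (D v)) * h)"
proof -
  let ?x = "mon (Poly_Mapping.single v (D v)) :: ('n, 'k) mpoly"
  have h: "h = (\<Sum>m\<in>keys h. cst (lookup h m) * mon m)"
    by (rule mpoly_expand) auto
  have "?x * h = (\<Sum>m\<in>keys h. cst (lookup h m) * mon (Poly_Mapping.single v (D v) + m))"
    by (subst h) (simp add: sum_distrib_left mon_add mult_ac)
  then have "subst_f (?x * h) = (\<Sum>m\<in>keys h. cst (lookup h m) * (f v * f_mon m))"
    by (simp add: subst_f_sum subst_f_cst_mult f_mult_f_mon)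
  also have "\<dots> = f v * subst_f h"
    unfolding subst_f_def by (simp add: sum_distrib_left mult_ac)
  finally show ?thesis by simp
qed

lemma pivot: "\<not> reduced m \<Longrightarrow> D (pivot m) \<le> lookup m (pivot m)"
  unfolding is_reduced_def pivot_var_def by (metis (mono_tags, lifting) not_le someI_ex)

lemma pivot_add: "\<not> reduced m \<Longrightarrow>
    Poly_Mapping.single (pivot m) (D (pivot m)) + (m - Poly_Mapping.single (pivot m) (D (pivot m))) = m"
  by (intro exponent_diff_single pivot)

lemma mdeg_pivot: "\<not> reduced m \<Longrightarrow> D (pivot m) + mdeg (m - Poly_Mapping.single (pivot m) (D (pivot m))) = mdeg m"
  by (metis pivot_add mdeg_add mdeg_single)

lemma std_vec_forms: "std_vec m \<in> forms (mdeg m)"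
proof (cases "reduced m")
  case False
  then show ?thesis
    using forms_mult[OF forms_mon[OF refl] f_forms] mdeg_pivot[OF False]
    by (simp add: std_form_def) (metis add.commute)
qed (simp add: std_form_def forms_mon)

lemma range_subst_f_sum:
  "(\<And>i. i \<in> A \<Longrightarrow> g i \<in> range subst_f) \<Longrightarrow> (\<Sum>i\<in>A. cst (c i) * g i) \<in> range subst_f"
proof -
  assume "\<And>i. i \<in> A \<Longrightarrow> g i \<in> range subst_f"
  then have "\<forall>i\<in>A. \<exists>h. g i = subst_f h" by blast
  then obtain h where "\<And>i. i \<in> A \<Longrightarrow> g i = subst_f (h i)" by metis
  then have "(\<Sum>i\<in>A. cst (c i) * g i) = subst_f (\<Sum>i\<in>A. cst (c i) * h i)"
    by (simp add: subst_f_sum subst_f_cst_mult)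
  then show ?thesis by simp
qed

text \<open>Induction on the degree of a monomial. Up to degree \<open>Suc s\<close> it is a
  combination of reduced monomials, which are their own images, and of products of some
  \<open>f v\<close> with monomials of smaller degree. Beyond that, a divisor of degree
  \<open>Suc s\<close> is expanded; no reduced monomial occurs in it, so every term has a factor
  \<open>f v\<close>. Finitely many degrees therefore suffice.\<close>

lemma surj_subst_f:
  assumes span: "\<And>t q. t \<le> Suc s \<Longrightarrow> q \<in> forms t \<Longrightarrow> \<exists>c. q = (\<Sum>m\<in>mons t. cst (c m) * std_vec m)"
    and s: "\<And>m. mdeg m = Suc s \<Longrightarrow> \<not> reduced m"
  shows "surj subst_f"
proof -
  have mon: "mon m \<in> range subst_f" for m
  proof (induction "mdeg m" arbitrary: m rule: less_induct)
    case less
    have f_mult: "mon m' * f v \<in> range subst_f" if m': "mdeg m' < mdeg m" for m' v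
    proof -
      obtain h where "mon m' = subst_f h" using less[OF m'] by blast
      then show ?thesis
        using f_mult_subst_f[of v h] by (metis mult.commute rangeI)
    qed
    show ?case
    proof (cases "mdeg m \<le> Suc s")
      case True
      then obtain c where c: "mon m = (\<Sum>m'\<in>mons (mdeg m). cst (c m') * std_vec m')"
        using span[of "mdeg m" "mon m"] forms_mon by blast
      have "std_vec m' \<in> range subst_f" if m': "m' \<in> mons (mdeg m)" for m'
      proof (cases "reduced m'")
        case True
        then have "std_vec m' = subst_f (mon m')"
          by (simp add: std_form_def f_mon_reduced)
        then show ?thesis by (simp only: rangeI)
      next
        case False
        then show ?thesis
          using m' mdeg_pivot[OF False] D_pos[of "pivot m'"] 
          by (auto simp: std_form_def mons_def intro: f_mult)
      qed
      then show ?thesis unfolding c by (rule range_subst_f_sum)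
    next
      case False
      then obtain a b where ab: "m = a + b" "mdeg a = Suc s"
        using exponent_below[of "Suc s" m] by auto
      obtain c where c: "mon a = (\<Sum>m'\<in>mons (Suc s). cst (c m') * std_vec m')"
        using span[of "Suc s" "mon a"] forms_mon ab by blast
      have "std_vec m' * mon b \<in> range subst_f" if m': "m' \<in> mons (Suc s)" for m'
      proof -
        have nr: "\<not> reduced m'" using s m' by (auto simp: mons_def)
        let ?m = "(m' - Poly_Mapping.single (pivot m') (D (pivot m'))) + b"
        have "mdeg ?m < mdeg m"
          using m' mdeg_pivot[OF nr] D_pos[of "pivot m'"] ab by (auto simp: mdeg_add mons_def)
        then have "mon ?m * f (pivot m') \<in> range subst_f" by (rule f_mult)
        then show ?thesis
          using nr by (simp add: std_form_def mon_add mult_ac)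
      qed
      then have "(\<Sum>m'\<in>mons (Suc s). cst (c m') * (std_vec m' * mon b)) \<in> range subst_f"
        by (rule range_subst_f_sum)
      then show ?thesis
        unfolding ab(1) mon_add c by (simp add: sum_distrib_right mult.assoc)
    qed
  qed
  have "h \<in> range subst_f" for h
    using range_subst_f_sum[of "keys h" mon "lookup h"] mon mpoly_expand[of "keys h" h] by simp
  then show ?thesis by auto
qed

end

section \<open>Freeness, regularity and the residue functional\<close>

locale surj_form_system = form_system +
  assumes surj: "surj subst_f"
begin

lemma lookup_subst_f:
  assumes "mdeg m' = t"
  shows "lookup (subst_f h) m' = (\<Sum>m\<in>mons t. lookup (f_mon m) m' * lookup h m)"
proof -
  have "lookup (subst_f h) m' = (\<Sum>m\<in>keys h \<union> mons t. lookup h m * lookup (f_mon m) m')"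
    by (simp add: subst_f_superset[of "keys h \<union> mons t"] lookup_sum)
  also have "\<dots> = (\<Sum>m\<in>mons t. lookup h m * lookup (f_mon m) m')"
  proof (rule sum.mono_neutral_right)
    have "lookup (f_mon m) m' = 0" if "mdeg m \<noteq> t" for m
    proof (rule ccontr)
      assume "lookup (f_mon m) m' \<noteq> 0"
      then have "m' \<in> keys (f_mon m)" by (simp add: in_keys_iff)
      then show False using f_mon_forms[of m] assms that by (auto simp: forms_def)
    qed
    then show "\<forall>m\<in>keys h \<union> mons t - mons t. lookup h m * lookup (f_mon m) m' = 0"
      by (simp add: mons_def)
  qed simp_all
  finally show ?thesis by (simp add: mult.commute)
qed

text \<open>As \<open>subst_f\<close> preserves degrees, it is in degree \<open>t\<close> a square
  matrix indexed by \<open>mons t\<close>; surjectivity of \<open>subst_f\<close> makes it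
  invertible.\<close>

lemma subst_f_graded_inj:
  assumes "\<And>m. mdeg m = t \<Longrightarrow> lookup (subst_f h) m = 0" "mdeg m = t"
  shows "lookup h m = 0"
proof (rule spans_on_inj[of "mons t" "\<lambda>m' m. lookup (f_mon m) m'" "lookup h"])
  show "spans_on (mons t) (\<lambda>m' m. lookup (f_mon m) m')"
    unfolding spans_on_def
  proof
    fix y :: "('a \<Rightarrow>\<^sub>0 nat) \<Rightarrow> 'b"
    obtain h where h: "(\<Sum>m\<in>mons t. cst (y m) * mon m) = subst_f h"
      using surj by blast
    have "(\<Sum>m\<in>mons t. lookup (f_mon m) m' * lookup h m) = y m'" if m': "m' \<in> mons t" for m'
    proof -
      have "lookup (\<Sum>m\<in>mons t. cst (y m) * mon m :: ('a, 'b) mpoly) m' = (\<Sum>m\<in>mons t. if m = m' then y m else 0)"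
        unfolding lookup_sum by (rule sum.cong) (auto simp: lookup_mon)
      moreover have "mdeg m' = t" using m' by (simp add: mons_def)
      ultimately show ?thesis
        using m' lookup_subst_f[of m' t h] unfolding h by simp
    qed
    then show "\<exists>x. \<forall>m'\<in>mons t. (\<Sum>m\<in>mons t. lookup (f_mon m) m' * x m) = y m'" by blast
  qed
  show "(\<Sum>m\<in>mons t. lookup (f_mon m) m' * lookup h m) = 0" if "m' \<in> mons t" for m'
    using that assms(1)[of m'] lookup_subst_f[of m' t h] by (simp add: mons_def)
  show "m \<in> mons t" using assms(2) by (simp add: mons_def)
qed simp

lemma inj_subst_f: "inj subst_f"
proof (rule injI)
  fix g h assume "subst_f g = subst_f h"
  then have "subst_f (g + cst (- 1) * h) = 0"
    unfolding subst_f_add subst_f_cst_mult by (simp add: cst_hom)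
  then have "lookup (g + cst (- 1) * h) m = 0" for m
    using subst_f_graded_inj[of "mdeg m" "g + cst (- 1) * h" m] by (simp only: lookup_zero)
  then have "lookup g m = lookup h m" for m
    unfolding lookup_add lookup_cst_mult by simp
  then show "g = h"
    by (rule poly_mapping_eqI)
qed

text \<open>In the source of \<open>subst_f\<close> the ideal becomes the monomial ideal of the
  \<open>x_v ^ D v\<close>, where membership is read off the exponents.\<close>

lemma ideal_gen_f:
  "ideal_gen (f ` A) = subst_f ` {h. \<forall>m\<in>keys h. \<exists>v\<in>A. D v \<le> lookup m v}" (is "_ = subst_f ` ?M")
proof (intro equalityI subsetI)
  fix x assume "x \<in> ideal_gen (f ` A)"
  then show "x \<in> subst_f ` ?M"
  proof (induction rule: ideal_gen_induct)
    case zero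
    show ?case by (rule image_eqI[of _ _ 0]) auto
  next
    case (step c a y)
    then obtain v h where v: "v \<in> A" "a = f v" and h: "y = subst_f h" "h \<in> ?M" by blast
    obtain h' where h': "c = subst_f h'" using surj by blast
    let ?x = "mon (Poly_Mapping.single v (D v)) :: ('a, 'b) mpoly"
    have "?x * h' + h \<in> ?M"
    proof safe
      fix m assume "m \<in> keys (?x * h' + h)"
      then consider "m \<in> keys (?x * h')" | "m \<in> keys h" using keys_add[of "?x * h'" h] by blast
      then show "\<exists>v\<in>A. D v \<le> lookup m v"
      proof cases
        case 1
        then obtain b where "m = Poly_Mapping.single v (D v) + b" using keys_mult[of ?x h'] by auto
        then have "D v \<le> lookup m v" by (simp add: lookup_add)
        then show ?thesis using v by blast
      qed (use h in blast)
    qed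
    moreover have "c * a + y = subst_f (?x * h' + h)"
      using f_mult_subst_f[of v h'] v h h' by (simp add: subst_f_add mult.commute)
    ultimately show ?case by blast
  qed
next
  fix x assume "x \<in> subst_f ` ?M"
  then obtain h where h: "x = subst_f h" "h \<in> ?M" by blast
  have "f_mon m \<in> ideal_gen (f ` A)" if m: "m \<in> keys h" for m
  proof -
    obtain v where v: "v \<in> A" "D v \<le> lookup m v" using h m by blast
    then have "f_mon m = f_mon (m - Poly_Mapping.single v (D v)) * f v"
      using f_mult_f_mon[of v "m - Poly_Mapping.single v (D v)"] exponent_diff_single[OF v(2)]
      by (simp add: mult.commute)
    then show ?thesis
      using v by (simp add: ideal_gen_mult ideal_gen_gen)
  qed
  then show "x \<in> ideal_gen (f ` A)"
    unfolding h subst_f_def by (intro ideal_gen_sum ideal_gen_mult) auto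
qed

text \<open>After transport to the monomial ideal, multiplication by \<open>x_v ^ D v\<close>
  changes only the exponent of \<open>v\<close>, so divisibility by powers of the earlier variables
  is unaffected. The exponent \<open>0\<close> is reduced, which keeps \<open>1\<close> out of the
  ideal.\<close>

lemma regular_sequence_f:
  assumes \<iota>: "bij_betw \<iota> {1..n} UNIV" and F: "\<And>i. i \<in> {1..n} \<Longrightarrow> F i = f (\<iota> i)"
  shows "regular_sequence n F"
proof -
  have img: "F ` A = f ` \<iota> ` A" if "A \<subseteq> {1..n}" for A
  proof -
    have "F ` A = (\<lambda>i. f (\<iota> i)) ` A"
    proof (rule image_cong[OF refl])
      fix i assume "i \<in> A"
      with that have "i \<in> {1..n}" by blast
      then show "F i = f (\<iota> i)" by (rule F)
    qed
    then show ?thesis by (simp only: image_image)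
  qed
  have "g \<in> ideal_gen (F ` {1..<i})" if i: "i \<in> {1..n}" and g: "g * F i \<in> ideal_gen (F ` {1..<i})" for i g
  proof -
    have sub: "{1..<i} \<subseteq> {1..n}" using i by auto
    obtain h where h: "g = subst_f h" using surj by blast
    let ?x = "mon (Poly_Mapping.single (\<iota> i) (D (\<iota> i))) :: ('a, 'b) mpoly"
    have "subst_f (?x * h) \<in> subst_f ` {h. \<forall>m\<in>keys h. \<exists>v\<in>\<iota> ` {1..<i}. D v \<le> lookup m v}"
      using g f_mult_subst_f[of "\<iota> i" h] unfolding img[OF sub] ideal_gen_f F[OF i] h
      by (simp add: mult.commute)
    then have M: "\<forall>m\<in>keys (?x * h). \<exists>v\<in>\<iota> ` {1..<i}. D v \<le> lookup m v"
      using inj_subst_f by (auto dest: injD)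
    have "\<exists>v\<in>\<iota> ` {1..<i}. D v \<le> lookup m v" if m: "m \<in> keys h" for m
    proof -
      have "Poly_Mapping.single (\<iota> i) (D (\<iota> i)) + m \<in> keys (?x * h)"
        using m by (simp add: in_keys_iff)
      then obtain j where j: "j \<in> {1..<i}"
          "D (\<iota> j) \<le> lookup (Poly_Mapping.single (\<iota> i) (D (\<iota> i)) + m) (\<iota> j)"
        using M by blast
      have "\<iota> i \<noteq> \<iota> j"
        using inj_on_eq_iff[OF bij_betw_imp_inj_on[OF \<iota>], of i j] j(1) i by auto
      then show ?thesis
        using j by (auto simp: lookup_add lookup_single)
    qed
    then show ?thesis
      unfolding img[OF sub] ideal_gen_f h by blast
  qed
  moreover have "1 \<notin> ideal_gen (F ` {1..n})"
  proof
    assume "1 \<in> ideal_gen (F ` {1..n})"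
    then obtain h where h: "1 = subst_f h" "\<forall>m\<in>keys h. \<exists>v\<in>\<iota> ` {1..n}. D v \<le> lookup m v"
      unfolding img[OF order_refl] ideal_gen_f by blast
    have "reduced 0" using D_pos by (simp add: is_reduced_def)
    then have "subst_f (mon 0) = subst_f h"
      using f_mon_reduced[of 0] h(1) by (metis mon_0 subst_f_mon)
    then have "h = mon 0" using inj_subst_f by (metis injD)
    then have "0 \<in> keys h" by (simp add: in_keys_iff)
    then obtain v where "D v \<le> 0" using h(2) by (metis lookup_zero)
    then show False using D_pos[of v] by simp
  qed
  ultimately show ?thesis
    unfolding regular_sequence_def by blast
qed

abbreviation "corner \<equiv> corner_exp D"

text \<open>The coefficient of the corner monomial in the expansion along the
  \<open>f^a x^b\<close>; it spans the dual of the socle modulo the \<open>f v\<close>.\<close>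

definition residue :: "('a, 'b) mpoly \<Rightarrow> 'b" where
  "residue p = lookup (inv_into UNIV subst_f p) corner"

lemma residue_subst_f: "residue (subst_f h) = lookup h corner"
  by (simp add: residue_def inj_subst_f)

lemma residue_add: "residue (p + q) = residue p + residue q"
proof -
  obtain g h where "p = subst_f g" "q = subst_f h" using surj by blast
  then show ?thesis
    by (simp add: subst_f_add[symmetric] residue_subst_f lookup_add)
qed

lemma residue_cst_mult: "residue (cst c * p) = c * residue p"
proof -
  obtain h where "p = subst_f h" using surj by blast
  then show ?thesis
    by (simp add: subst_f_cst_mult[symmetric] residue_subst_f)
qed

text \<open>The corner monomial is not divisible by any \<open>x_v ^ D v\<close>.\<close>

lemma residue_f_mult: "residue (f v * p) = 0"
proof -
  obtain h where "p = subst_f h" using surj by blast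
  moreover have "corner \<noteq> Poly_Mapping.single v (D v) + m" for m
  proof
    assume "corner = Poly_Mapping.single v (D v) + m"
    then have "lookup corner v = lookup (Poly_Mapping.single v (D v) + m) v" by simp
    then show False using D_pos[of v] by (simp add: corner_exp_def lookup_add)
  qed
  ultimately show ?thesis
    by (simp add: f_mult_subst_f residue_subst_f lookup_mon_mult_0)
qed

lemma residue_corner: "residue (mon corner) = 1"
proof -
  have "reduced corner" using D_pos by (simp add: is_reduced_def corner_exp_def)
  then have "subst_f (mon corner) = mon corner" by (simp add: f_mon_reduced)
  then show ?thesis using residue_subst_f[of "mon corner"] by (simp add: lookup_mon)
qed

lemma residue_forms:
  assumes "p \<in> forms t" "t \<noteq> mdeg corner"
  shows "residue p = 0"
proof -
  obtain h where h: "p = subst_f h" using surj by blast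
  have "lookup h corner = 0"
  proof (rule subst_f_graded_inj[OF _ refl])
    fix m :: "'a \<Rightarrow>\<^sub>0 nat" assume "mdeg m = mdeg corner"
    then have "m \<notin> keys p" using assms by (auto simp: forms_def)
    then show "lookup (subst_f h) m = 0" by (simp add: h in_keys_iff)
  qed
  then show ?thesis by (simp add: h residue_subst_f)
qed

end


section \<open>The Koszul complex and resolutions\<close>

text \<open>The Koszul cochain differential, the transpose of the map in \<open>koszul\<close>: a
  cochain assigns ring elements to index sets.\<close>

definition kdiff :: "(nat \<Rightarrow> 'a::comm_ring_1) \<Rightarrow> (nat set \<Rightarrow> 'a) \<Rightarrow> nat set \<Rightarrow> 'a" where
  "kdiff x f S = (\<Sum>v\<in>S. (-1) ^ card {u\<in>S. u < v} * x v * f (S - {v}))"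

lemma kdiff_cong: "(\<And>v. v \<in> S \<Longrightarrow> f (S - {v}) = g (S - {v})) \<Longrightarrow> kdiff x f S = kdiff x g S"
  unfolding kdiff_def by (rule sum.cong) simp_all

lemma kdiff_add: "kdiff x (\<lambda>U. f U + g U) S = kdiff x f S + kdiff x g S"
  unfolding kdiff_def by (simp add: distrib_left sum.distrib)

lemma kdiff_diff: "kdiff x (\<lambda>U. f U - g U) S = kdiff x f S - kdiff x g S"
  unfolding kdiff_def by (simp add: right_diff_distrib sum_subtractf)

lemma kdiff_mult: "kdiff x (\<lambda>U. c * f U) S = c * kdiff x f S"
  unfolding kdiff_def by (simp add: sum_distrib_left mult_ac)

text \<open>All of \<open>T\<close> precedes the largest index \<open>t\<close>, so the signs inside
  \<open>T\<close> persist and the term at \<open>t\<close> has sign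
  \<open>(-1) ^ card T\<close>.\<close>

lemma kdiff_insert:
  assumes "finite T" "\<And>u. u \<in> T \<Longrightarrow> u < t"
  shows "kdiff x f (insert t T) = kdiff x (\<lambda>U. f (insert t U)) T + (-1) ^ card T * x t * f T"
proof -
  have t: "t \<notin> T" using assms(2) by blast
  have 1: "{u \<in> insert t T. u < v} = {u \<in> T. u < v}" if "v \<in> T" for v
    using assms(2)[OF that] by auto
  have 2: "{u \<in> insert t T. u < t} = T"
    using assms(2) by auto
  have 3: "insert t T - {v} = insert t (T - {v})" if "v \<in> T" for v
    using t that by auto
  have "(\<Sum>v\<in>T. (-1) ^ card {u \<in> insert t T. u < v} * x v * f (insert t T - {v})) =
      kdiff x (\<lambda>U. f (insert t U)) T"
    unfolding kdiff_def by (rule sum.cong) (simp_all only: 1 3)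
  moreover have "insert t T - {t} = T" using t by simp
  ultimately show ?thesis
    using assms(1) t 2 by (simp add: kdiff_def[of x f "insert t T"] add.commute)
qed

text \<open>Splitting off the largest index leaves two mixed terms; they cancel because
  \<open>T\<close> and \<open>T - {v}\<close> differ by one element and so carry opposite
  signs.\<close>

lemma kdiff_kdiff: "finite S \<Longrightarrow> kdiff x (kdiff x f) S = 0"
proof (induction S arbitrary: f rule: finite_linorder_max_induct)
  case empty
  show ?case by (simp add: kdiff_def)
next
  case (insert t T)
  have "kdiff x (\<lambda>U. kdiff x f (insert t U)) T =
      kdiff x (\<lambda>U. kdiff x (\<lambda>W. f (insert t W)) U + - ((-1) ^ card T * x t) * f U) T"
  proof (rule kdiff_cong)
    fix v assume v: "v \<in> T"
    have cT: "card T = Suc (card (T - {v}))"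
      using card_Suc_Diff1[OF insert.hyps(1) v] by (rule sym)
    have "kdiff x f (insert t (T - {v})) =
        kdiff x (\<lambda>W. f (insert t W)) (T - {v}) + (-1) ^ card (T - {v}) * x t * f (T - {v})"
      by (rule kdiff_insert) (use insert.hyps in auto)
    then show "kdiff x f (insert t (T - {v})) =
        kdiff x (\<lambda>W. f (insert t W)) (T - {v}) + - ((-1) ^ card T * x t) * f (T - {v})"
      unfolding cT power_Suc by simp
  qed
  also have "\<dots> = - ((-1) ^ card T * x t) * kdiff x f T"
    unfolding kdiff_add kdiff_mult insert.IH by simp
  finally show ?case
    using insert.hyps by (subst kdiff_insert) auto
qed

lemma ideal_gen_image_sum:
  assumes "finite A" "y \<in> ideal_gen (x ` A)"
  shows "\<exists>r. y = (\<Sum>v\<in>A. r v * x v)"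
  using assms(2)
proof (induction rule: ideal_gen_induct)
  case zero
  show ?case by (rule exI[of _ "\<lambda>_. 0"]) simp
next
  case (step c a y)
  then obtain r u where r: "y = (\<Sum>v\<in>A. r v * x v)" and u: "u \<in> A" "a = x u" by blast
  have "c * a + y = (\<Sum>v\<in>A. (r(u := r u + c)) v * x v)"
    unfolding r using assms(1) u by (simp add: sum.remove[of A u] distrib_right add_ac)
  then show ?case by blast
qed

lemma kdiff_in_ideal: "kdiff x f S \<in> ideal_gen (x ` S)"
proof -
  have "(-1) ^ card {u\<in>S. u < v} * f (S - {v}) * x v \<in> ideal_gen (x ` S)" if "v \<in> S" for v
    using that by (intro ideal_gen_mult ideal_gen_gen) simp
  then show ?thesis
    unfolding kdiff_def by (intro ideal_gen_sum) (simp add: mult_ac)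
qed

lemma ideal_imp_kdiff:
  assumes S: "finite S" and y: "y \<in> ideal_gen (x ` S)"
  shows "\<exists>g. y = kdiff x g S"
proof -
  obtain r where r: "y = (\<Sum>v\<in>S. r v * x v)"
    using ideal_gen_image_sum[OF S y] by blast
  \<comment> \<open>For \<open>U = S - {v}\<close> only the summand at \<open>v\<close> remains: the
    coefficient of \<open>x v\<close> with the Koszul sign undone.\<close>
  define g where "g U = (\<Sum>v\<in>S - U. (-1) ^ card {u\<in>S. u < v} * r v)" for U
  have "(-1) ^ card {u\<in>S. u < v} * x v * g (S - {v}) = r v * x v" if v: "v \<in> S" for v
  proof -
    have "S - (S - {v}) = {v}" using v by auto
    then show ?thesis
      by (simp add: g_def mult_ac power_mult_distrib[symmetric] left_right_inverse_power
          flip: mult.assoc[of "(-1) ^ _" "(-1) ^ _"])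
  qed
  then have "kdiff x g S = y"
    unfolding kdiff_def r by (rule sum.cong[OF refl])
  then show ?thesis by blast
qed

text \<open>The complex with differential \<open>kdiff\<close> on \<open>{1..m + 1}\<close> is the mapping cone of
  multiplication by \<open>x\<^sub>m\<^sub>+\<^sub>1\<close> on the one on \<open>{1..m}\<close>.\<close>

lemma kdiff_exact:
  assumes reg: "regular_sequence n x" and "m \<le> n" "q < m"
    and "\<And>S. S \<subseteq> {1..m} \<Longrightarrow> card S = Suc q \<Longrightarrow> kdiff x f S = 0"
  shows "\<exists>g. \<forall>S. S \<subseteq> {1..m} \<and> card S = q \<longrightarrow> f S = kdiff x g S"
  using assms(2-)
proof (induction m arbitrary: q f)
  case 0
  then show ?case by simp
next
  case (Suc m)
  let ?t = "Suc m"
  have ins: "kdiff x h (insert ?t U) = kdiff x (\<lambda>W. h (insert ?t W)) U + (-1) ^ card U * x ?t * h U"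
    if U: "U \<subseteq> {1..m}" for U h
    using U by (intro kdiff_insert finite_subset[OF U]) auto
  have cl: "kdiff x f (insert ?t U) = 0" if U: "U \<subseteq> {1..m}" "card U = q" for U
  proof (rule Suc.prems(3))
    show "insert ?t U \<subseteq> {1..Suc m}" using U by auto
    have "?t \<notin> U" using U by auto
    then show "card (insert ?t U) = Suc q" using U finite_subset[OF U(1)] by simp
  qed
  have "\<exists>g. \<forall>S. S \<subseteq> {1..m} \<and> card S = q \<longrightarrow> f S = kdiff x g S"
  proof (cases "q < m")
    case True
    show ?thesis
    proof (rule Suc.IH[OF _ True])
      fix S assume S: "S \<subseteq> {1..m}" "card S = Suc q"
      have "S \<subseteq> {1..Suc m}" by (rule order_trans[OF S(1)]) auto
      then show "kdiff x f S = 0" using S(2) by (rule Suc.prems(3))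
    qed (use Suc.prems(1) in simp)
  next
    case False
    then have q: "q = m" using Suc.prems(2) by simp
    \<comment> \<open>For \<open>q = m\<close> there is a single set, and the cocycle condition puts
      \<open>x ?t\<close> times its value into the ideal of the earlier elements; regularity then
      cancels \<open>x ?t\<close>.\<close>
    have "(-1) ^ m * x ?t * f {1..m} = - kdiff x (\<lambda>W. f (insert ?t W)) {1..m}"
      using cl[of "{1..m}"] ins[of "{1..m}" f] q by (simp add: eq_neg_iff_add_eq_0 add.commute)
    then have "(-1) ^ m * ((-1) ^ m * x ?t * f {1..m}) =
        (- ((-1) ^ m)) * kdiff x (\<lambda>W. f (insert ?t W)) {1..m}"
      by simp
    then have "f {1..m} * x ?t = (- ((-1) ^ m)) * kdiff x (\<lambda>W. f (insert ?t W)) {1..m}"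
      by (simp add: mult_ac left_right_inverse_power flip: mult.assoc[of "(-1) ^ _" "(-1) ^ _"])
    also have "\<dots> \<in> ideal_gen (x ` {1..m})"
      by (intro ideal_gen_mult kdiff_in_ideal)
    finally have "f {1..m} \<in> ideal_gen (x ` {1..m})"
      using reg Suc.prems(1) unfolding regular_sequence_def
      by (metis atLeastAtMost_iff atLeastLessThanSuc_atLeastAtMost le_add1 plus_1_eq_Suc)
    then obtain g where "f {1..m} = kdiff x g {1..m}"
      using ideal_imp_kdiff[of "{1..m}"] by blast
    moreover have "S = {1..m}" if "S \<subseteq> {1..m}" "card S = q" for S
      using that q by (intro card_subset_eq) simp_all
    ultimately show ?thesis by blast
  qed
  then obtain g1 where g1: "\<And>S. S \<subseteq> {1..m} \<Longrightarrow> card S = q \<Longrightarrow> f S = kdiff x g1 S"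
    by blast
  have "\<exists>g2. \<forall>U. U \<subseteq> {1..m} \<and> Suc (card U) = q \<longrightarrow>
      f (insert ?t U) = kdiff x g2 U + (-1) ^ card U * x ?t * g1 U"
  proof (cases q)
    case 0
    then show ?thesis by simp
  next
    case (Suc q')
    \<comment> \<open>The values on sets containing \<open>?t\<close>, corrected by the contribution
      of \<open>g1\<close>, again form a cocycle on \<open>{1..m}\<close>.\<close>
    define f2 where "f2 U = f (insert ?t U) - (-1) ^ q' * x ?t * g1 U" for U
    have "\<exists>g. \<forall>S. S \<subseteq> {1..m} \<and> card S = q' \<longrightarrow> f2 S = kdiff x g S"
    proof (rule Suc.IH)
      fix U assume U: "U \<subseteq> {1..m}" "card U = Suc q'"
      have "kdiff x f2 U = kdiff x (\<lambda>W. f (insert ?t W)) U - (-1) ^ q' * x ?t * kdiff x g1 U"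
        unfolding f2_def kdiff_diff kdiff_mult ..
      also have "\<dots> = kdiff x f (insert ?t U)"
        using U g1[of U] by (simp add: ins Suc)
      finally show "kdiff x f2 U = 0" using cl[of U] U Suc by simp
    qed (use Suc Suc.prems in auto)
    then obtain g2 where "\<And>U. U \<subseteq> {1..m} \<Longrightarrow> card U = q' \<Longrightarrow> f2 U = kdiff x g2 U" by blast
    then show ?thesis
      using Suc by (intro exI[of _ g2]) (auto simp: f2_def algebra_simps)
  qed
  then obtain g2 where g2: "\<And>U. U \<subseteq> {1..m} \<Longrightarrow> Suc (card U) = q \<Longrightarrow>
      f (insert ?t U) = kdiff x g2 U + (-1) ^ card U * x ?t * g1 U"
    by blast
  \<comment> \<open>The two components of the cone are glued according to whether \<open>?t\<close>
    belongs to the set.\<close>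
  define g where "g S = (if ?t \<in> S then g2 (S - {?t}) else g1 S)" for S
  have "f S = kdiff x g S" if S: "S \<subseteq> {1..Suc m}" "card S = q" for S
  proof (cases "?t \<in> S")
    case True
    define U where "U = S - {?t}"
    have U: "S = insert ?t U" "U \<subseteq> {1..m}" "?t \<notin> U"
      using S True by (auto simp: U_def)
    have "Suc (card U) = q"
      using U S finite_subset[OF U(2)] by simp
    moreover have "kdiff x (\<lambda>W. g (insert ?t W)) U = kdiff x g2 U"
      using U(3) by (intro kdiff_cong) (simp add: g_def)
    ultimately show ?thesis
      using g2[of U] U by (simp add: ins g_def)
  next
    case False
    then have "S \<subseteq> {1..m}" using S by (auto simp: le_Suc_eq)
    moreover have "kdiff x g S = kdiff x g1 S"
      using False by (intro kdiff_cong) (simp add: g_def)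
    ultimately show ?thesis using g1 S by simp
  qed
  then show ?case by blast
qed

section \<open>Homogeneous components and lifting along a resolution\<close>

lemma mat_app_diff: "mat_app B M (\<lambda>c. f c - g c) r = mat_app B M f r - mat_app B M g r"
  for M :: "'b \<Rightarrow> 'c \<Rightarrow> 'a::comm_ring_1"
  unfolding mat_app_def by (simp add: right_diff_distrib sum_subtractf)

lemma mat_app_cong: "(\<And>c. c \<in> B \<Longrightarrow> f c = g c) \<Longrightarrow> mat_app B M f r = mat_app B M g r"
  unfolding mat_app_def by (rule sum.cong) simp_all

text \<open>The matrix acts on values and \<open>kdiff\<close> on index sets, so these two
  differentials of a double complex commute.\<close>

lemma mat_app_kdiff:
  "mat_app B M (\<lambda>c. kdiff x (\<lambda>U. K U c) S) r = kdiff x (\<lambda>U. mat_app B M (K U) r) S"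
  unfolding mat_app_def kdiff_def
  by (simp only: sum_distrib_left, subst sum.swap) (simp add: mult_ac)

text \<open>The degree \<open>t\<close> component of an element of \<open>R(-s)\<close>; adding
  \<open>s\<close> on the left avoids truncated subtraction.\<close>

definition hpart :: "nat \<Rightarrow> nat \<Rightarrow> ('n, 'k::zero) mpoly \<Rightarrow> ('n, 'k) mpoly" where
  "hpart t s p = Poly_Mapping.mapp (\<lambda>m c. if mdeg m + s = t then c else 0) p"

lemma lookup_hpart: "lookup (hpart t s p) m = (if mdeg m + s = t then lookup p m else 0)"
  by (simp add: hpart_def lookup_mapp when_def in_keys_iff)

lemma hpart_graded: "graded_entry t s (hpart t s p)"
  by (auto simp: graded_entry_def in_keys_iff lookup_hpart split: if_splits)

lemma hpart_id: "graded_entry t s p \<Longrightarrow> hpart t s p = p"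
  by (rule poly_mapping_eqI) (auto simp: graded_entry_def in_keys_iff lookup_hpart)

lemma hpart_sum: "hpart t s (\<Sum>i\<in>A. f i) = (\<Sum>i\<in>A. hpart t s (f i))"
  by (rule poly_mapping_eqI) (simp add: lookup_hpart lookup_sum)

lemma hpart_mult:
  fixes p q :: "('n::finite, 'k::comm_ring_1) mpoly"
  assumes q: "graded_entry a b q"
  shows "hpart t b (q * p) = q * hpart t a p"
proof -
  have q': "mdeg m1 + b = a" if "m1 \<in> keys q" for m1
    using q that by (simp add: graded_entry_def)
  have "lookup (hpart t b (q * p)) m = lookup (q * hpart t a p) m" for m
  proof (cases "mdeg m + b = t")
    case True
    have "m \<notin> keys (q * (p - hpart t a p))"
    proof
      assume "m \<in> keys (q * (p - hpart t a p))"
      then obtain m1 m2 where m: "m = m1 + m2" "m1 \<in> keys q" "m2 \<in> keys (p - hpart t a p)"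
        using keys_mult[of q "p - hpart t a p"] by blast
      then have "mdeg m2 + a \<noteq> t"
        by (auto simp: in_keys_iff lookup_minus lookup_hpart)
      then show False using True m q'[of m1] by (simp add: mdeg_add)
    qed
    then have "lookup (q * p - q * hpart t a p) m = 0"
      by (simp add: in_keys_iff right_diff_distrib)
    then show ?thesis
      using True by (simp add: lookup_hpart lookup_minus)
  next
    case False
    have "m \<notin> keys (q * hpart t a p)"
    proof
      assume "m \<in> keys (q * hpart t a p)"
      then obtain m1 m2 where m: "m = m1 + m2" "m1 \<in> keys q" "m2 \<in> keys (hpart t a p)"
        using keys_mult[of q "hpart t a p"] by blast
      then have "mdeg m2 + a = t"
        using hpart_graded[of t a p] by (auto simp: graded_entry_def)
      then show False using False m q'[of m1] by (simp add: mdeg_add)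
    qed
    then show ?thesis using False by (simp add: lookup_hpart in_keys_iff)
  qed
  then show ?thesis by (rule poly_mapping_eqI)
qed

lemma graded_entry_sum: "(\<And>i. i \<in> A \<Longrightarrow> graded_entry a b (f i)) \<Longrightarrow> graded_entry a b (\<Sum>i\<in>A. f i)"
  using keys_sum[of f A] unfolding graded_entry_def by blast

lemma graded_entry_kdiff:
  fixes x :: "nat \<Rightarrow> ('n::finite, 'k::comm_ring_1) mpoly"
  assumes "\<And>v. v \<in> S \<Longrightarrow> x v \<in> forms 1" "\<And>v. v \<in> S \<Longrightarrow> graded_entry a b (f (S - {v}))"
  shows "graded_entry (Suc a) b (kdiff x f S)"
  unfolding kdiff_def
proof (rule graded_entry_sum)
  fix v assume v: "v \<in> S"
  have "(-1) ^ card {u \<in> S. u < v} * x v \<in> forms 1"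
    using assms(1)[OF v] by (cases "even (card {u \<in> S. u < v})") (auto intro: forms_uminus)
  then show "graded_entry (Suc a) b ((-1) ^ card {u \<in> S. u < v} * x v * f (S - {v}))"
    using keys_mult[of "(-1) ^ card {u \<in> S. u < v} * x v" "f (S - {v})"] assms(2)[OF v]
    unfolding graded_entry_def forms_def by (fastforce simp: mdeg_add)
qed

abbreviation res_diff :: "('b, 'a::comm_semiring_1) graded_seq \<Rightarrow> nat \<Rightarrow> ('b \<Rightarrow> 'a) \<Rightarrow> 'b \<Rightarrow> 'a" where
  "res_diff C l \<equiv> mat_app (basis C (Suc l)) (diff C (Suc l))"

text \<open>Degree-preserving maps commute with taking components, so the degree \<open>t\<close>
  part of any preimage is a preimage.\<close>

lemma homogeneous_preimage:
  fixes C :: "('b, ('n::finite, 'k::field) mpoly) graded_seq"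
  assumes C: "graded_free_resolution I C"
    and y: "\<And>r. r \<in> basis C l \<Longrightarrow> graded_entry t (shift C l r) (y r)"
    and g: "\<And>r. r \<in> basis C l \<Longrightarrow> y r = res_diff C l g r"
  shows "\<exists>g'. (\<forall>c\<in>basis C (Suc l). graded_entry t (shift C (Suc l) c) (g' c)) \<and>
    (\<forall>r\<in>basis C l. y r = res_diff C l g' r)"
proof (intro exI conjI ballI)
  let ?g = "\<lambda>c. hpart t (shift C (Suc l) c) (g c)"
  fix r assume r: "r \<in> basis C l"
  have "graded_entry (shift C (Suc l) c) (shift C l r) (diff C (Suc l) r c)" if "c \<in> basis C (Suc l)" for c
    using C r that unfolding graded_free_resolution_def by blast
  then have "res_diff C l ?g r = hpart t (shift C l r) (res_diff C l g r)"
    unfolding mat_app_def hpart_sum by (intro sum.cong[OF refl] hpart_mult[symmetric])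
  also have "\<dots> = y r"
    using hpart_id[OF y[OF r]] g[OF r] by simp
  finally show "y r = res_diff C l ?g r" ..
qed (rule hpart_graded)

text \<open>\<open>Tor\<^sub>n\<^sub>-\<^sub>j(R/I, k)\<close> is computed both by \<open>C \<otimes> k\<close> and, as the Koszul complex is self-dual, by the
  cochain complex of \<open>kdiff\<close> on \<open>R/I\<close>. A cocycle \<open>b\<close> is lifted along \<open>C\<close> to an element \<open>\<kappa>\<close> of the
  \<open>(n-j)\<close>-th module; if that has no generator in the degree of \<open>\<kappa>\<close>, then \<open>\<kappa>\<close> has coefficients in
  the ideal of the variables, and a homotopy built downwards makes \<open>b\<close> a coboundary.\<close>

lemma koszul_cocycle_imp_copies:
  fixes C :: "('b, ('n::finite, 'k::field) mpoly) graded_seq"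
  assumes C: "graded_free_resolution I C"
    and reg: "regular_sequence n x" and x: "\<And>i. i \<in> {1..n} \<Longrightarrow> x i \<in> forms 1"
    and maximal: "\<And>p. lookup p 0 = 0 \<Longrightarrow> p \<in> ideal_gen (x ` {1..n})"
    and j: "j \<le> n"
    and b: "\<And>S. S \<subseteq> {1..n} \<Longrightarrow> card S = j \<Longrightarrow> b S \<in> forms t"
    and cocycle: "\<And>S. S \<subseteq> {1..n} \<Longrightarrow> card S = Suc j \<Longrightarrow> kdiff x b S \<in> I"
    and not_coboundary: "\<nexists>c. \<forall>S. S \<subseteq> {1..n} \<and> card S = j \<longrightarrow> b S - kdiff x c S \<in> I"
  shows "copies C (n - j) (t + (n - j)) \<noteq> {}"
proof
  assume no_copies: "copies C (n - j) (t + (n - j)) = {}"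
  define P where "P k S \<longleftrightarrow> S \<subseteq> {1..n} \<and> card S = k" for k and S :: "nat set"
  have P_fin: "finite S" if "P k S" for k S
    using that finite_subset[of S "{1..n}"] by (simp add: P_def)
  have P_diff: "P k (S - {v})" if "P (Suc k) S" "v \<in> S" for k S v
    using that P_fin[OF that(1)] by (auto simp: P_def)
  obtain b0 where b0: "basis C 0 = {b0}" "shift C 0 b0 = 0"
    and I: "I = {res_diff C 0 f b0 | f. True}"
    using C unfolding graded_free_resolution_def by auto
  have exact: "(\<forall>r\<in>basis C l. res_diff C l f r = 0) \<longleftrightarrow>
      (\<exists>g. \<forall>c\<in>basis C (Suc l). f c = res_diff C (Suc l) g c)" for l f
    using C unfolding graded_free_resolution_def by blast
  \<comment> \<open>A stage of the zigzag through the double complex: a homogeneous cochain with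
    values in the \<open>l\<close>-th module whose Koszul differential is a boundary from the next
    module.\<close>
  define good where "good l \<kappa> \<longleftrightarrow>
      (\<forall>S. P (j + l) S \<longrightarrow> (\<forall>r\<in>basis C l. graded_entry (t + l) (shift C l r) (\<kappa> S r))) \<and>
      (\<forall>S. P (Suc (j + l)) S \<longrightarrow>
         (\<exists>g. \<forall>r\<in>basis C l. kdiff x (\<lambda>U. \<kappa> U r) S = res_diff C l g r))"
    for l and \<kappa> :: "nat set \<Rightarrow> 'b \<Rightarrow> ('n, 'k) mpoly"
  define lift where "lift l \<kappa> \<kappa>' \<longleftrightarrow>
      (\<forall>S. P (Suc (j + l)) S \<longrightarrow> (\<forall>r\<in>basis C l. kdiff x (\<lambda>U. \<kappa> U r) S = res_diff C l (\<kappa>' S) r))"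
    for l and \<kappa> \<kappa>' :: "nat set \<Rightarrow> 'b \<Rightarrow> ('n, 'k) mpoly"
  have start: "good 0 (\<lambda>S _. b S)"
    unfolding good_def
  proof (intro conjI allI impI)
    fix S assume "P (j + 0) S"
    then have "b S \<in> forms t" using b by (simp add: P_def)
    then show "\<forall>r\<in>basis C 0. graded_entry (t + 0) (shift C 0 r) (b S)"
      by (simp add: b0 graded_entry_def forms_def)
  next
    fix S assume "P (Suc (j + 0)) S"
    then have "kdiff x b S \<in> I" using cocycle by (simp add: P_def)
    then show "\<exists>g. \<forall>r\<in>basis C 0. kdiff x b S = res_diff C 0 g r"
      by (auto simp: I b0)
  qed
  \<comment> \<open>The lift \<open>\<kappa>'\<close> can be continued: \<open>res_diff\<close>
    sends its Koszul differential to \<open>kdiff\<close> applied twice, which is zero, and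
    exactness provides the next preimage.\<close>
  have step: "\<exists>\<kappa>'. good (Suc l) \<kappa>' \<and> lift l \<kappa> \<kappa>'" if \<kappa>: "good l \<kappa>" for l \<kappa>
  proof -
    have "\<exists>g. P (Suc (j + l)) S \<longrightarrow>
        (\<forall>c\<in>basis C (Suc l). graded_entry (Suc (t + l)) (shift C (Suc l) c) (g c)) \<and>
        (\<forall>r\<in>basis C l. kdiff x (\<lambda>U. \<kappa> U r) S = res_diff C l g r)" for S
    proof (cases "P (Suc (j + l)) S")
      case True
      then obtain g where g: "\<And>r. r \<in> basis C l \<Longrightarrow> kdiff x (\<lambda>U. \<kappa> U r) S = res_diff C l g r"
        using \<kappa> unfolding good_def by blast
      have "graded_entry (Suc (t + l)) (shift C l r) (kdiff x (\<lambda>U. \<kappa> U r) S)" if r: "r \<in> basis C l" for r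
      proof (rule graded_entry_kdiff)
        fix v assume v: "v \<in> S"
        show "x v \<in> forms 1" using True v x by (auto simp: P_def)
        show "graded_entry (t + l) (shift C l r) (\<kappa> (S - {v}) r)"
          using \<kappa> P_diff[OF True v] r unfolding good_def by blast
      qed
      then show ?thesis
        using homogeneous_preimage[OF C _ g, of "Suc (t + l)"] by blast
    qed simp
    then obtain \<kappa>' where \<kappa>': "\<And>S c. P (Suc (j + l)) S \<Longrightarrow> c \<in> basis C (Suc l) \<Longrightarrow>
          graded_entry (Suc (t + l)) (shift C (Suc l) c) (\<kappa>' S c)"
        "\<And>S r. P (Suc (j + l)) S \<Longrightarrow> r \<in> basis C l \<Longrightarrow>
          kdiff x (\<lambda>U. \<kappa> U r) S = res_diff C l (\<kappa>' S) r"
      by metis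
    have "\<exists>g. \<forall>c\<in>basis C (Suc l). kdiff x (\<lambda>U. \<kappa>' U c) S = res_diff C (Suc l) g c"
      if S: "P (Suc (Suc (j + l))) S" for S
    proof -
      have "res_diff C l (\<lambda>c. kdiff x (\<lambda>U. \<kappa>' U c) S) r = 0" if r: "r \<in> basis C l" for r
      proof -
        have "res_diff C l (\<lambda>c. kdiff x (\<lambda>U. \<kappa>' U c) S) r = kdiff x (\<lambda>U. res_diff C l (\<kappa>' U) r) S"
          by (rule mat_app_kdiff)
        also have "\<dots> = kdiff x (kdiff x (\<lambda>U. \<kappa> U r)) S"
          using \<kappa>'(2)[OF P_diff[OF S] r] by (intro kdiff_cong) simp
        finally show ?thesis using kdiff_kdiff[OF P_fin[OF S]] by simp
      qed
      then show ?thesis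
        using exact[of l "\<lambda>c. kdiff x (\<lambda>U. \<kappa>' U c) S"] by blast
    qed
    then have "good (Suc l) \<kappa>'"
      using \<kappa>'(1) unfolding good_def by simp
    moreover have "lift l \<kappa> \<kappa>'"
      using \<kappa>'(2) unfolding lift_def by blast
    ultimately show ?thesis by blast
  qed
  have "\<exists>\<kappa>. \<kappa> 0 = (\<lambda>S _. b S) \<and> (\<forall>l. good l (\<kappa> l) \<and> lift l (\<kappa> l) (\<kappa> (Suc l)))"
  proof -
    \<comment> \<open>Dependent choice of one lift after another.\<close>
    define \<kappa> where "\<kappa> = rec_nat (\<lambda>S _. b S) (\<lambda>l a. SOME a'. good (Suc l) a' \<and> lift l a a')"
    have "good l (\<kappa> l)" for l
    proof (induction l)
      case 0
      show ?case using start by (simp add: \<kappa>_def)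
    next
      case (Suc l)
      then show ?case using someI_ex[OF step[OF Suc]] by (simp add: \<kappa>_def)
    qed
    moreover have "lift l (\<kappa> l) (\<kappa> (Suc l))" for l
      using someI_ex[OF step[OF \<open>good l (\<kappa> l)\<close>]] by (simp add: \<kappa>_def)
    ultimately show ?thesis by (intro exI[of _ \<kappa>]) (simp add: \<kappa>_def)
  qed
  then obtain \<kappa> where \<kappa>0: "\<kappa> 0 = (\<lambda>S _. b S)"
    and good: "\<And>l. good l (\<kappa> l)" and lift: "\<And>l. lift l (\<kappa> l) (\<kappa> (Suc l))"
    by blast
  \<comment> \<open>Descending induction on \<open>l\<close>, starting where the only index set left
    is \<open>{1..n}\<close>.\<close>
  have homotopy: "\<exists>h h'. \<forall>S. P (j + l) S \<longrightarrow>
      (\<forall>r\<in>basis C l. \<kappa> l S r = res_diff C l (h S) r + kdiff x (\<lambda>U. h' U r) S)"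
    if "l \<le> n - j" for l
    using that
  proof (induction rule: inc_induct)
    case base
    have S: "S = {1..n}" if "P (j + (n - j)) S" for S
      using that j by (intro card_subset_eq) (simp_all add: P_def)
    have "\<exists>g. \<kappa> (n - j) {1..n} r = kdiff x g {1..n}" if r: "r \<in> basis C (n - j)" for r
    proof -
      have "graded_entry (t + (n - j)) (shift C (n - j) r) (\<kappa> (n - j) {1..n} r)"
        using good[of "n - j"] r j by (simp add: good_def P_def)
      moreover have "shift C (n - j) r \<noteq> t + (n - j)"
        using no_copies r by (auto simp: copies_def)
      ultimately have "0 \<notin> keys (\<kappa> (n - j) {1..n} r)"
        by (auto simp: graded_entry_def)
      then show ?thesis
        using ideal_imp_kdiff[OF _ maximal] by (simp add: in_keys_iff)
    qed
    then obtain h' where "\<And>r. r \<in> basis C (n - j) \<Longrightarrow> \<kappa> (n - j) {1..n} r = kdiff x (h' r) {1..n}"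
      by metis
    then show ?case
      using S by (intro exI[of _ "\<lambda>_ _. 0"] exI[of _ "\<lambda>U r. h' r U"]) (auto simp: mat_app_def)
  next
    case (step l)
    then obtain h h' where h: "\<And>S r. P (Suc (j + l)) S \<Longrightarrow> r \<in> basis C (Suc l) \<Longrightarrow>
        \<kappa> (Suc l) S r = res_diff C (Suc l) (h S) r + kdiff x (\<lambda>U. h' U r) S"
      by auto
    \<comment> \<open>Subtracting the boundary of \<open>h'\<close> turns \<open>\<kappa> l\<close>
      into a cocycle, since its lift is \<open>h\<close> up to the same correction; the Koszul
      complex is exact there because \<open>j + l < n\<close>.\<close>
    have "\<exists>g. \<forall>S. S \<subseteq> {1..n} \<and> card S = j + l \<longrightarrow> \<kappa> l S r - res_diff C l (h' S) r = kdiff x g S"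
      if r: "r \<in> basis C l" for r
    proof (rule kdiff_exact[OF reg order_refl])
      show "j + l < n" using step.hyps by simp
      fix S assume "S \<subseteq> {1..n}" "card S = Suc (j + l)"
      then have S: "P (Suc (j + l)) S" by (simp add: P_def)
      have "kdiff x (\<lambda>U. \<kappa> l U r - res_diff C l (h' U) r) S =
          res_diff C l (\<kappa> (Suc l) S) r - res_diff C l (\<lambda>c. kdiff x (\<lambda>U. h' U c) S) r"
        using lift[of l] S r unfolding kdiff_diff mat_app_kdiff lift_def by simp
      also have "\<dots> = res_diff C l (\<lambda>c. \<kappa> (Suc l) S c - kdiff x (\<lambda>U. h' U c) S) r"
        by (rule mat_app_diff[symmetric])
      also have "\<dots> = res_diff C l (res_diff C (Suc l) (h S)) r"
        using h[OF S] by (intro mat_app_cong) simp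
      also have "\<dots> = 0"
        using exact[of l "res_diff C (Suc l) (h S)"] r by blast
      finally show "kdiff x (\<lambda>U. \<kappa> l U r - res_diff C l (h' U) r) S = 0" .
    qed
    then obtain g where g: "\<And>r S. r \<in> basis C l \<Longrightarrow> S \<subseteq> {1..n} \<and> card S = j + l \<Longrightarrow>
        \<kappa> l S r - res_diff C l (h' S) r = kdiff x (g r) S"
      by metis
    show ?case
      using g by (intro exI[of _ h'] exI[of _ "\<lambda>U r. g r U"]) (simp add: P_def diff_eq_eq add.commute)
  qed
  \<comment> \<open>At \<open>l = 0\<close> the boundary term lies in \<open>I\<close>, which leaves
    \<open>b\<close> as a coboundary modulo \<open>I\<close>.\<close>
  obtain h h' where "\<And>S. P j S \<Longrightarrow> b S = res_diff C 0 (h S) b0 + kdiff x (\<lambda>U. h' U b0) S"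
    using homotopy[of 0] by (auto simp: \<kappa>0 b0)
  then have "\<forall>S. S \<subseteq> {1..n} \<and> card S = j \<longrightarrow> b S - kdiff x (\<lambda>U. h' U b0) S \<in> I"
    unfolding I P_def by auto
  with not_coboundary show False by blast
qed


section \<open>Socle elements from the residue pairing\<close>

text \<open>A right kernel vector forces the determinant to vanish, and then a nonzero column
  \<open>(y1, y2)\<close> gives the left kernel vector \<open>(y2, -y1)\<close>.\<close>

lemma singular_2x2:
  fixes c1 c2 r11 r12 r21 r22 :: "'k::field"
  assumes "c1 \<noteq> 0 \<or> c2 \<noteq> 0" "r11 * c1 + r12 * c2 = 0" "r21 * c1 + r22 * c2 = 0"
  shows "\<exists>l1 l2. (l1 \<noteq> 0 \<or> l2 \<noteq> 0) \<and> l1 * r11 + l2 * r21 = 0 \<and> l1 * r12 + l2 * r22 = 0"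
proof -
  have "c1 * (r11 * r22 - r12 * r21) = r22 * (r11 * c1 + r12 * c2) - r12 * (r21 * c1 + r22 * c2)"
    "c2 * (r11 * r22 - r12 * r21) = r11 * (r21 * c1 + r22 * c2) - r21 * (r11 * c1 + r12 * c2)"
    by (simp_all add: algebra_simps)
  then have det: "r11 * r22 = r12 * r21" using assms by auto
  consider "r22 \<noteq> 0 \<or> r12 \<noteq> 0" | "r21 \<noteq> 0 \<or> r11 \<noteq> 0" | "r11 = 0" "r12 = 0" "r21 = 0" "r22 = 0"
    by blast
  then show ?thesis
  proof cases
    case 1
    then show ?thesis
      using det by (intro exI[of _ r22] exI[of _ "- r12"] conjI) (auto simp: mult_ac)
  next
    case 2
    then show ?thesis
      using det by (intro exI[of _ r21] exI[of _ "- r11"] conjI) (auto simp: mult_ac)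
  next
    case 3
    then show ?thesis by (intro exI[of _ 1] exI[of _ 0]) simp
  qed
qed

section \<open>Linear forms that annihilate the ideal under the residue pairing\<close>

definition linear_form :: "('n::finite \<Rightarrow> 'k) \<Rightarrow> ('n, 'k::comm_ring_1) mpoly" where
  "linear_form w = (\<Sum>v\<in>UNIV. cst (w v) * var v)"

lemma linear_form_forms: "linear_form w \<in> forms 1"
  unfolding linear_form_def by (intro forms_sum forms_cst_mult forms_var)

lemma linear_form_comb:
  "linear_form (\<lambda>v. a * w v + b * w' v) = cst a * linear_form w + cst b * linear_form w'"
  unfolding linear_form_def by (simp add: cst_hom distrib_right sum.distrib sum_distrib_left mult.assoc)

lemma hpart_0 [simp]: "hpart t s 0 = 0"
  by (rule poly_mapping_eqI) (simp add: lookup_hpart)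

context surj_form_system
begin

lemma residue_0 [simp]: "residue 0 = 0"
  using residue_cst_mult[of 0 0] by simp

lemma residue_diff: "residue (p - q) = residue p - residue q"
  using residue_add[of "p - q" q] by simp

lemma residue_sum: "residue (\<Sum>i\<in>A. g i) = (\<Sum>i\<in>A. residue (g i))"
  by (induction A rule: infinite_finite_induct) (simp_all add: residue_add)

lemma residue_linear_form_mult: "residue (linear_form w * q) = (\<Sum>v\<in>UNIV. w v * residue (var v * q))"
  unfolding linear_form_def by (simp add: sum_distrib_right residue_sum mult.assoc residue_cst_mult)

text \<open>Only the generators \<open>G g\<close> themselves have to be tested: a proper monomial
  multiple, times a linear form, exceeds the degree of the corner, and multiples of
  \<open>f v\<close> have residue zero.\<close>

lemma residue_linear_form_ideal:
  assumes G: "\<And>g. g \<in> J \<Longrightarrow> G g \<in> forms t" "Suc t = mdeg corner"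
    and w: "\<And>g. g \<in> J \<Longrightarrow> residue (linear_form w * G g) = 0"
    and q: "q \<in> ideal_gen (range f \<union> G ` J)"
  shows "residue (linear_form w * q) = 0"
  using q
proof (induction rule: ideal_gen_induct)
  case zero
  show ?case by simp
next
  case (step c a y)
  have "residue (linear_form w * (c * a)) = 0"
    using step.hyps(1)
  proof
    assume "a \<in> range f"
    then obtain v where "a = f v" by blast
    then have "linear_form w * (c * a) = f v * (linear_form w * c)" by (simp add: mult_ac)
    then show ?thesis by (simp only: residue_f_mult)
  next
    assume "a \<in> G ` J"
    then obtain g where g: "a = G g" "g \<in> J" by blast
    have "residue (mon m * (linear_form w * G g)) = 0" for m
    proof (cases "mdeg m = 0")
      case True
      then have "m = 0"
        by (intro poly_mapping_eqI) (simp add: mdeg_UNIV)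
      then show ?thesis using w[OF g(2)] by simp
    next
      case False
      have "mon m * (linear_form w * G g) \<in> forms (mdeg m + (1 + t))"
        by (intro forms_mult forms_mon linear_form_forms G g refl)
      then show ?thesis
        by (rule residue_forms) (use False G(2) in simp)
    qed
    then have "residue ((\<Sum>m\<in>keys c. cst (lookup c m) * mon m) * (linear_form w * G g)) = 0"
      by (simp add: sum_distrib_right residue_sum mult.assoc residue_cst_mult)
    then show ?thesis
      using mpoly_expand[of "keys c" c] g by (simp add: mult_ac)
  qed
  then show ?case
    using step.IH by (simp add: distrib_left residue_add)
qed

text \<open>Below degree \<open>t\<close> the forms \<open>G g\<close> contribute nothing, so the
  component lies in the ideal of the \<open>f v\<close>.\<close>

lemma residue_hpart_ideal:
  assumes G: "\<And>g. g \<in> J \<Longrightarrow> G g \<in> forms t" "t' < t"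
    and q: "q \<in> ideal_gen (range f \<union> G ` J)"
  shows "residue (hpart t' 0 q * r) = 0"
  using q
proof (induction rule: ideal_gen_induct)
  case zero
  show ?case by simp
next
  case (step c a y)
  have "residue (hpart t' 0 (a * c) * r) = 0"
    using step.hyps(1)
  proof
    assume "a \<in> range f"
    then obtain v where v: "a = f v" by blast
    have "graded_entry (D v) 0 (f v)"
      using f_forms[of v] by (simp add: graded_entry_def forms_def)
    then show ?thesis
      unfolding v by (simp add: hpart_mult mult.assoc residue_f_mult)
  next
    assume "a \<in> G ` J"
    then obtain g where g: "a = G g" "g \<in> J" by blast
    have "graded_entry t 0 (G g)"
      using G(1)[OF g(2)] by (simp add: graded_entry_def forms_def)
    moreover have "hpart t' t c = 0"
      using G(2) by (intro poly_mapping_eqI) (simp add: lookup_hpart)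
    ultimately show ?thesis
      unfolding g by (simp add: hpart_mult)
  qed
  moreover have "hpart t' 0 (c * a + y) = hpart t' 0 (a * c) + hpart t' 0 y"
    by (rule poly_mapping_eqI) (simp add: lookup_hpart lookup_add mult.commute)
  ultimately show ?case
    using step.IH by (simp add: distrib_right residue_add)
qed

text \<open>The linear forms \<open>w\<close> with \<open>residue (w * G g) = 0\<close> for all \<open>g\<close> form the degree one part of
  the annihilator of \<open>I/(f)\<close>; it has dimension at least two. A point \<open>p\<close> where two of them vanish gives the
  functional \<open>q \<mapsto> q(p)\<close> on the quadrics, and the form that represents it under the residue pairing
  is a socle element. The relation \<open>w\<^sub>1 * w\<^sub>2 - w\<^sub>2 * w\<^sub>1 = 0\<close> gives the other class.\<close>

lemma socle_element_and_cocycle: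
  fixes G :: "'g \<Rightarrow> ('a, 'b) mpoly"
  assumes n: "3 \<le> CARD('a)" and J: "finite J" "card J + 2 = CARD('a)"
    and s: "mdeg corner = Suc (Suc t)"
    and G: "\<And>g. g \<in> J \<Longrightarrow> G g \<in> forms (Suc t)"
    and I: "I = ideal_gen (range f \<union> G ` J)"
    and perfect: "\<And>l. \<exists>a\<in>forms t. \<forall>m\<in>mons 2. residue (a * mon m) = l m"
    and u: "u1 \<in> forms (Suc t)" "u2 \<in> forms (Suc t)"
    and codim: "\<And>q. q \<in> forms (Suc t) \<Longrightarrow> \<exists>c1 c2. q - (cst c1 * u1 + cst c2 * u2) \<in> I"
  shows "(\<exists>a\<in>forms t. a \<notin> I \<and> (\<forall>v. var v * a \<in> I)) \<and>
    (\<exists>b. (\<forall>v. b v \<in> forms (Suc t)) \<and> (\<nexists>c. \<forall>v. b v - var v * c \<in> I))"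
proof -
  define ann where "ann w \<longleftrightarrow> (\<forall>g\<in>J. residue (linear_form w * G g) = 0)" for w
  have ann_ideal: "residue (linear_form w * q) = 0" if "ann w" "q \<in> I" for w q
    using residue_linear_form_ideal[of J G "Suc t" w q] that G s unfolding ann_def I by simp
  \<comment> \<open>If \<open>a\<close> represents the functional dual to \<open>x_v^2\<close> on
    quadrics, then \<open>x_v * a\<close> pairs with a linear form to its coefficient at
    \<open>v\<close>.\<close>
  have nondeg: "\<exists>q\<in>forms (Suc t). residue (linear_form w * q) \<noteq> 0" if w: "w v \<noteq> 0" for w v
  proof -
    obtain a where a: "a \<in> forms t"
      "\<And>m. m \<in> mons 2 \<Longrightarrow> residue (a * mon m) = (if m = Poly_Mapping.single v 2 then 1 else 0)"
      using perfect[of "\<lambda>m. if m = Poly_Mapping.single v 2 then 1 else 0"] by blast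
    have q: "var v * a \<in> forms (Suc t)"
      using forms_mult[OF forms_var a(1)] by simp
    have "residue (var u * (var v * a)) = (if u = v then 1 else 0)" for u
    proof -
      let ?m = "Poly_Mapping.single u 1 + Poly_Mapping.single v (1::nat)"
      have "?m \<in> mons 2" by (simp add: mons_def mdeg_add)
      moreover have "?m = Poly_Mapping.single v 2 \<longleftrightarrow> u = v"
      proof
        assume "?m = Poly_Mapping.single v 2"
        then have "lookup ?m v = 2" by simp
        then show "u = v" by (auto simp: lookup_add lookup_single when_def split: if_splits)
      next
        assume "u = v"
        then show "?m = Poly_Mapping.single v 2"
          by (simp add: single_add[symmetric] numeral_2_eq_2)
      qed
      ultimately have "residue (a * mon ?m) = (if u = v then 1 else 0)"
        using a(2) by simp
      then show ?thesis by (simp only: mon_add mult_ac)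
    qed
    then have "residue (linear_form w * (var v * a)) = w v"
      by (simp add: residue_linear_form_mult if_distrib[of "(*) _"] cong: if_cong)
    then show ?thesis using q w by (intro bexI[OF _ q]) simp
  qed
  let ?A = "\<lambda>g v. residue (var v * G g)"
  \<comment> \<open>There are \<open>CARD('a) - 2\<close> equations. The first solution
    \<open>w1\<close> uses all coordinates; the second one is sought with coordinate
    \<open>i\<close> set to zero, where \<open>w1\<close> is nonzero, so the two are
    independent.\<close>
  have "card J < card (UNIV :: 'a set)" using J by simp
  then obtain w1 where w1: "\<exists>v. w1 v \<noteq> 0" "\<And>g. g \<in> J \<Longrightarrow> (\<Sum>v\<in>UNIV. ?A g v * w1 v) = 0"
    using homogeneous_system_solution[of J UNIV ?A] J(1) by auto
  obtain i where i: "w1 i \<noteq> 0" using w1(1) by blast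
  have "card J < card (UNIV - {i} :: 'a set)" using J by (simp add: card_Diff_singleton)
  then obtain x where x: "\<exists>v\<in>UNIV - {i}. x v \<noteq> 0" "\<And>g. g \<in> J \<Longrightarrow> (\<Sum>v\<in>UNIV - {i}. ?A g v * x v) = 0"
    using homogeneous_system_solution[of J "UNIV - {i}" ?A] J(1) by auto
  define w2 where "w2 v = (if v = i then 0 else x v)" for v
  have w2i: "w2 i = 0" by (simp add: w2_def)
  obtain i2 where "i2 \<noteq> i" "x i2 \<noteq> 0" using x(1) by blast
  then have i2: "w2 i2 \<noteq> 0" by (simp add: w2_def)
  have "(\<Sum>v\<in>UNIV. ?A g v * w2 v) = 0" if "g \<in> J" for g
  proof -
    have "(\<Sum>v\<in>UNIV. ?A g v * w2 v) = (\<Sum>v\<in>UNIV - {i}. ?A g v * x v)"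
      by (rule sum.mono_neutral_cong_right) (auto simp: w2_def)
    then show ?thesis using x(2)[OF that] by simp
  qed
  then have ann: "ann w1" "ann w2"
    using w1(2) unfolding ann_def residue_linear_form_mult by (simp_all add: mult.commute)
  \<comment> \<open>Two linear conditions on at least three coordinates have a nonzero common
    solution; the boolean \<open>e\<close> indexes the two conditions.\<close>
  have "\<exists>p. (\<exists>v\<in>UNIV. p v \<noteq> 0) \<and> (\<forall>e\<in>UNIV. (\<Sum>v\<in>UNIV. (if e then w1 v else w2 v) * p v) = 0)"
    using n by (intro homogeneous_system_solution) simp_all
  then obtain p j where j: "p j \<noteq> 0"
    and "\<And>e. (\<Sum>v\<in>UNIV. (if e then w1 v else w2 v) * p v) = 0"
    by blast
  from this(2)[of True] this(2)[of False]
  have p: "(\<Sum>v\<in>UNIV. w1 v * p v) = 0" "(\<Sum>v\<in>UNIV. w2 v * p v) = 0"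
    by simp_all
  \<comment> \<open>Modulo \<open>I\<close>, \<open>q\<close> is a combination of \<open>u1\<close>
    and \<open>u2\<close>. A nontrivial one orthogonal to both \<open>w1\<close> and
    \<open>w2\<close> would make the 2-by-2 residue matrix singular; some nonzero combination of
    \<open>w1\<close> and \<open>w2\<close> would then annihilate all forms of this degree, against
    \<open>nondeg\<close>.\<close>
  have dual: "q \<in> I"
    if q: "q \<in> forms (Suc t)" "residue (linear_form w1 * q) = 0" "residue (linear_form w2 * q) = 0" for q
  proof -
    obtain c1 c2 where c: "q - (cst c1 * u1 + cst c2 * u2) \<in> I"
      using codim[OF q(1)] by blast
    have r: "residue (linear_form w * q) =
        residue (linear_form w * u1) * c1 + residue (linear_form w * u2) * c2"
      if "ann w" "q - (cst c1 * u1 + cst c2 * u2) \<in> I" for w q c1 c2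
    proof -
      have "residue (linear_form w * q) = residue (linear_form w * (cst c1 * u1 + cst c2 * u2))"
        using ann_ideal[OF that] by (simp add: right_diff_distrib residue_diff)
      also have "linear_form w * (cst c1 * u1 + cst c2 * u2) =
          cst c1 * (linear_form w * u1) + cst c2 * (linear_form w * u2)"
        by (simp add: distrib_left mult_ac)
      finally show ?thesis by (simp add: residue_add residue_cst_mult mult.commute)
    qed
    have "c1 = 0 \<and> c2 = 0"
    proof (rule ccontr)
      assume "\<not> (c1 = 0 \<and> c2 = 0)"
      then obtain l1 l2 where l: "l1 \<noteq> 0 \<or> l2 \<noteq> 0"
        "l1 * residue (linear_form w1 * u1) + l2 * residue (linear_form w2 * u1) = 0"
        "l1 * residue (linear_form w1 * u2) + l2 * residue (linear_form w2 * u2) = 0"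
        using singular_2x2[of c1 c2] r[OF ann(1) c] r[OF ann(2) c] q(2,3) by metis
      define w where "w v = l1 * w1 v + l2 * w2 v" for v
      have w: "linear_form w = cst l1 * linear_form w1 + cst l2 * linear_form w2"
        unfolding w_def by (rule linear_form_comb)
      have res_w: "residue (linear_form w * q) =
          l1 * residue (linear_form w1 * q) + l2 * residue (linear_form w2 * q)" for q
        unfolding w by (simp add: distrib_right residue_add residue_cst_mult mult.assoc)
      have "ann w" using ann unfolding ann_def by (simp add: res_w)
      obtain v where "w v \<noteq> 0"
      proof (cases "l1 = 0")
        case True
        then have "w i2 \<noteq> 0" using l(1) i2 by (simp add: w_def)
        then show ?thesis by (rule that)
      next
        case False
        then have "w i \<noteq> 0" using i w2i by (simp add: w_def)
        then show ?thesis by (rule that)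
      qed
      then obtain q' where q': "q' \<in> forms (Suc t)" "residue (linear_form w * q') \<noteq> 0"
        using nondeg by blast
      obtain c1' c2' where "q' - (cst c1' * u1 + cst c2' * u2) \<in> I"
        using codim[OF q'(1)] by blast
      then have "residue (linear_form w * q') = 0"
        using r[OF \<open>ann w\<close>] l(2,3) by (simp add: res_w)
      with q'(2) show False ..
    qed
    with c show "q \<in> I" by simp
  qed
  have "\<exists>a\<in>forms t. a \<notin> I \<and> (\<forall>v. var v * a \<in> I)"
  proof -
    \<comment> \<open>\<open>a\<close> represents evaluation of quadrics at \<open>p\<close>, so
      \<open>x_v * a\<close> is orthogonal to every linear form vanishing at
      \<open>p\<close>.\<close>
    obtain a where a: "a \<in> forms t" "\<And>m. m \<in> mons 2 \<Longrightarrow> residue (a * mon m) = mon_eval m p"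
      using perfect[of "\<lambda>m. mon_eval m p"] by blast
    have res: "residue (var u * (var v * a)) = p u * p v" for u v
    proof -
      let ?m = "Poly_Mapping.single u 1 + Poly_Mapping.single v (1::nat)"
      have "?m \<in> mons 2" by (simp add: mons_def mdeg_add)
      then have "residue (a * mon ?m) = mon_eval ?m p" by (rule a(2))
      also have "\<dots> = p u * p v" by (simp add: mon_eval_add) (simp add: mon_eval_def)
      finally show ?thesis by (simp only: mon_add mult_ac)
    qed
    have "var v * a \<in> I" for v
    proof (rule dual)
      show "var v * a \<in> forms (Suc t)"
        using forms_mult[OF forms_var a(1)] by simp
      have "residue (linear_form w * (var v * a)) = (\<Sum>u\<in>UNIV. w u * p u) * p v" for w
        unfolding residue_linear_form_mult res sum_distrib_right by (simp only: mult.assoc)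
      then show "residue (linear_form w1 * (var v * a)) = 0" "residue (linear_form w2 * (var v * a)) = 0"
        using p by simp_all
    qed
    \<comment> \<open>In degree \<open>t\<close> the residue pairing kills \<open>I\<close>, but
      \<open>x_j^2 * a\<close> has residue \<open>p j * p j\<close>.\<close>
    moreover have "a \<notin> I"
    proof
      assume "a \<in> I"
      then have "residue (hpart t 0 a * (var j * var j)) = 0"
        using residue_hpart_ideal[of J G "Suc t" t a] G unfolding I by blast
      moreover have "hpart t 0 a = a"
        using a(1) by (intro hpart_id) (simp add: forms_def graded_entry_def)
      ultimately have "residue (var j * (var j * a)) = 0" by (simp add: mult_ac)
      then show False unfolding res using j by simp
    qed
    ultimately show ?thesis using a(1) by blast
  qed
  moreover have "\<exists>b. (\<forall>v. b v \<in> forms (Suc t)) \<and> (\<nexists>c. \<forall>v. b v - var v * c \<in> I)"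
  proof -
    obtain q where q: "q \<in> forms (Suc t)" "residue (linear_form w2 * q) \<noteq> 0"
      using nondeg i2 by blast
    \<comment> \<open>This functional detects the class: commutativity of \<open>w1\<close> and
      \<open>w2\<close> makes it vanish on coboundaries, and elements of \<open>I\<close> do not
      change it. On a family supported at \<open>i\<close> only the second sum survives, as
      \<open>w2 i = 0\<close>.\<close>
    define \<Psi> where "\<Psi> b = (\<Sum>v\<in>UNIV. w2 v * residue (linear_form w1 * b v)) -
      (\<Sum>v\<in>UNIV. w1 v * residue (linear_form w2 * b v))" for b :: "'a \<Rightarrow> ('a, 'b) mpoly"
    define b where "b v = (if v = i then q else 0)" for v
    have "\<Psi> b \<noteq> 0"
    proof -
      have "w * residue (h * b v) = (if v = i then w * residue (h * q) else 0)" for w h v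
        by (simp add: b_def)
      then show ?thesis
        using i w2i q(2) by (simp add: \<Psi>_def)
    qed
    have "\<not> (\<forall>v. b v - var v * c \<in> I)" for c
    proof
      assume I: "\<forall>v. b v - var v * c \<in> I"
      have "residue (linear_form w * b v) = residue (var v * (linear_form w * c))" if "ann w" for w v
        using ann_ideal[OF that, of "b v - var v * c"] I
        by (simp add: right_diff_distrib residue_diff mult_ac)
      then have "\<Psi> b = residue (linear_form w2 * (linear_form w1 * c)) - residue (linear_form w1 * (linear_form w2 * c))"
        unfolding \<Psi>_def residue_linear_form_mult[of w2 "linear_form w1 * c"]
          residue_linear_form_mult[of w1 "linear_form w2 * c"] using ann by simp
      also have "\<dots> = 0" by (simp add: mult_ac)
      finally show False using \<open>\<Psi> b \<noteq> 0\<close> by simp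
    qed
    moreover have "b v \<in> forms (Suc t)" for v using q by (simp add: b_def)
    ultimately show ?thesis by blast
  qed
  ultimately show ?thesis ..
qed

end


section \<open>Openness at the special tuple\<close>

lemma forms_eqI:
  assumes "p \<in> forms t" "q \<in> forms t" "\<And>m. m \<in> mons t \<Longrightarrow> lookup p m = lookup q m"
  shows "p = q"
proof (rule poly_mapping_eqI)
  fix m
  show "lookup p m = lookup q m"
  proof (cases "m \<in> mons t")
    case False
    then have "m \<notin> keys p" "m \<notin> keys q" using assms(1,2) by (auto simp: forms_iff)
    then show ?thesis by (simp add: in_keys_iff)
  qed (rule assms(3))
qed

lemma mdeg_eq_0_iff: "mdeg m = 0 \<longleftrightarrow> m = (0 :: 'n::finite \<Rightarrow>\<^sub>0 nat)"
proof
  assume "mdeg m = 0"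
  then show "m = 0" by (intro poly_mapping_eqI) (simp add: mdeg_UNIV)
qed simp

lemma mdeg_eq_1:
  fixes m :: "'n::finite \<Rightarrow>\<^sub>0 nat"
  assumes "mdeg m = 1"
  shows "\<exists>v. m = Poly_Mapping.single v 1"
proof -
  have "m \<noteq> 0" using assms by auto
  then obtain v where "lookup m v \<noteq> 0" by (metis lookup_zero poly_mapping_eqI)
  then have m: "Poly_Mapping.single v 1 + (m - Poly_Mapping.single v 1) = m"
    by (intro exponent_diff_single) simp
  then have "1 + mdeg (m - Poly_Mapping.single v 1) = 1"
    using assms mdeg_add[of "Poly_Mapping.single v 1" "m - Poly_Mapping.single v 1"] by simp
  then have "m - Poly_Mapping.single v 1 = 0"
    using mdeg_eq_0_iff[of "m - Poly_Mapping.single v 1"] by linarith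
  then show ?thesis using m by (metis add.right_neutral)
qed

lemma lookup_le_mdeg: "lookup m v \<le> mdeg (m :: 'n::finite \<Rightarrow>\<^sub>0 nat)"
  unfolding mdeg_UNIV by (rule member_le_sum) simp_all

text \<open>The reduced monomials are divisors of the corner monomial.\<close>

lemma reduced_complement:
  assumes "is_reduced D m"
  shows "\<exists>k. corner_exp D = m + k \<and> mdeg (corner_exp D) = mdeg m + mdeg k"
proof -
  have "lookup m v \<le> lookup (corner_exp D) v" for v
    using assms unfolding is_reduced_def corner_exp_def lookup_expo
    by (metis Suc_diff_1 less_Suc_eq_le not_less_zero gr0I)
  then have "m + (corner_exp D - m) = corner_exp D" by (rule exponent_diff)
  then show ?thesis by (metis mdeg_add)
qed

lemma poly_fun_mon_mult: "poly_fun (\<lambda>F. lookup (mon a * F i) m)"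
proof (cases "\<exists>m'. m = a + m'")
  case True
  then obtain m' where "m = a + m'" by blast
  then show ?thesis by (simp add: poly_fun_coord)
next
  case False
  then show ?thesis by (simp add: lookup_mon_mult_0 poly_fun_const)
qed

text \<open>At \<open>F0\<close> the coefficient matrix of the vectors \<open>V F0 m\<close> is the
  identity.\<close>

lemma open_near_spanning:
  fixes V :: "(nat \<Rightarrow> ('n::finite, 'k::field) mpoly) \<Rightarrow> ('n \<Rightarrow>\<^sub>0 nat) \<Rightarrow> ('n, 'k) mpoly"
  assumes V: "\<And>m m'. poly_fun (\<lambda>F. lookup (V F m) m')"
    and V0: "\<And>m. m \<in> mons t \<Longrightarrow> V F0 m = mon m"
    and V_forms: "\<And>F m. F \<in> form_tuples N e \<Longrightarrow> m \<in> mons t \<Longrightarrow> V F m \<in> forms t"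
  shows "open_near N e F0 (\<lambda>F. \<forall>q\<in>forms t. \<exists>c. q = (\<Sum>m\<in>mons t. cst (c m) * V F m))"
proof (rule open_near_mono)
  show "open_near N e F0 (\<lambda>F. spans_on (mons t) (\<lambda>m' m. lookup (V F m) m'))"
  proof (rule open_near_spans_on)
    have "(\<Sum>m\<in>mons t. lookup (V F0 m) m' * y m) = y m'" if m': "m' \<in> mons t" for m' and y :: "_ \<Rightarrow> 'k"
    proof -
      have "(\<Sum>m\<in>mons t. lookup (V F0 m) m' * y m) = (\<Sum>m\<in>mons t. if m = m' then y m else 0)"
        by (rule sum.cong) (simp_all add: V0 lookup_mon)
      then show ?thesis using m' by simp
    qed
    then show "spans_on (mons t) (\<lambda>m' m. lookup (V F0 m) m')"
      unfolding spans_on_def by blast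
  qed (simp_all add: V)
next
  fix F assume F: "F \<in> form_tuples N e" and sp: "spans_on (mons t) (\<lambda>m' m. lookup (V F m) m')"
  show "\<forall>q\<in>forms t. \<exists>c. q = (\<Sum>m\<in>mons t. cst (c m) * V F m)"
  proof
    fix q :: "('n, 'k) mpoly" assume q: "q \<in> forms t"
    obtain c where c: "\<forall>m'\<in>mons t. (\<Sum>m\<in>mons t. lookup (V F m) m' * c m) = lookup q m'"
      using sp unfolding spans_on_def by blast
    have "q = (\<Sum>m\<in>mons t. cst (c m) * V F m)"
    proof (rule forms_eqI[OF q])
      show "(\<Sum>m\<in>mons t. cst (c m) * V F m) \<in> forms t"
        by (intro forms_sum forms_cst_mult V_forms F)
      fix m' :: "'n \<Rightarrow>\<^sub>0 nat" assume "m' \<in> mons t"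
      then show "lookup q m' = lookup (\<Sum>m\<in>mons t. cst (c m) * V F m) m'"
        using c by (simp add: lookup_sum mult.commute)
    qed
    then show "\<exists>c. q = (\<Sum>m\<in>mons t. cst (c m) * V F m)" by blast
  qed
qed

section \<open>The data of the problem and the special tuple\<close>

locale ghost_data =
  fixes n d :: nat and deg e :: "nat \<Rightarrow> nat" and \<iota> :: "nat \<Rightarrow> 'n::finite"
  assumes card: "CARD('n) = n" and n3: "3 \<le> n"
    and deg_gt: "\<And>i. i \<in> {1..n} \<Longrightarrow> 2 < deg i"
    and d: "d = (\<Sum>i=1..n. deg i)"
    and e: "\<And>i. i \<in> {1..n} \<Longrightarrow> e i = deg i" "\<And>i. i \<in> {n+1..2*n-2} \<Longrightarrow> e i = d - n - 1"
    and \<iota>: "bij_betw \<iota> {1..n} UNIV"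
begin

definition idx :: "'n \<Rightarrow> nat" where
  "idx = the_inv_into {1..n} \<iota>"

definition D :: "'n \<Rightarrow> nat" where
  "D v = deg (idx v)"

text \<open>The degree of the socle element: the added generators have degree \<open>Suc t\<close>,
  the corner \<open>Suc (Suc t)\<close>.\<close>

definition t :: nat where
  "t = d - n - 2"

abbreviation "sys F \<equiv> (\<lambda>v. F (idx v))"

abbreviation "socle_exp \<equiv> corner_exp D"

definition side :: "'n \<Rightarrow> ('n \<Rightarrow>\<^sub>0 nat)" where
  "side v = socle_exp - Poly_Mapping.single v 1"

text \<open>The restriction makes the tuple extensional, as the product in
  \<open>form_tuples\<close> demands.\<close>

definition special :: "nat \<Rightarrow> ('n, 'k::field) mpoly" where
  "special = restrict (\<lambda>i. if i \<le> n then mon (Poly_Mapping.single (\<iota> i) (deg i))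
     else mon (side (\<iota> (i - n)))) {1..2*n-2}"

abbreviation "ideal F \<equiv> ideal_gen (F ` {1..2*n-2})"

abbreviation "open_special \<equiv> open_near (2*n-2) e special"

lemma idx_\<iota>: "i \<in> {1..n} \<Longrightarrow> idx (\<iota> i) = i"
  unfolding idx_def using \<iota> by (auto simp: bij_betw_def intro: the_inv_into_f_f)

lemma \<iota>_idx: "\<iota> (idx v) = v"
  unfolding idx_def using \<iota> by (auto simp: bij_betw_def intro: f_the_inv_into_f)

lemma idx_range: "idx v \<in> {1..n}"
  unfolding idx_def using bij_betwE[OF bij_betw_the_inv_into[OF \<iota>]] by blast

lemma D_gt: "2 < D v"
  unfolding D_def by (intro deg_gt idx_range)

lemma sum_D: "(\<Sum>v\<in>UNIV. D v) = d"
  unfolding d by (subst sum.reindex_bij_betw[OF \<iota>, symmetric]) (simp add: D_def idx_\<iota>)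

lemma mdeg_corner: "mdeg socle_exp = Suc (Suc t)" and d_eq: "d = t + n + 2" and t_ge: "2 \<le> t"
proof -
  have "mdeg socle_exp + n = (\<Sum>v\<in>UNIV. D v - 1) + (\<Sum>v\<in>(UNIV :: 'n set). 1)"
    unfolding corner_exp_def mdeg_expo using card by simp
  also have "\<dots> = (\<Sum>v\<in>UNIV. D v)"
  proof -
    have "D v - 1 + 1 = D v" for v using D_gt[of v] by simp
    then show ?thesis unfolding sum.distrib[symmetric] by (simp only:)
  qed
  finally have 1: "mdeg socle_exp + n = d" by (simp only: sum_D)
  have "2 \<le> D v - 1" for v using D_gt[of v] by simp
  then have "(\<Sum>v\<in>(UNIV :: 'n set). 2) \<le> (\<Sum>v\<in>UNIV. D v - 1)"
    by (intro sum_mono)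
  then have "2 * n \<le> mdeg socle_exp"
    unfolding corner_exp_def mdeg_expo using card by simp
  with 1 n3 show "mdeg socle_exp = Suc (Suc t)" "d = t + n + 2" "2 \<le> t"
    unfolding t_def by linarith+
qed

lemma lookup_corner: "lookup socle_exp v = D v - 1"
  by (simp add: corner_exp_def)

lemma side_add: "Poly_Mapping.single v 1 + side v = socle_exp"
  unfolding side_def by (rule exponent_diff_single) (use D_gt[of v] in \<open>simp add: lookup_corner\<close>)

lemma mdeg_side: "mdeg (side v) = Suc t"
  using side_add[of v] mdeg_corner mdeg_add[of "Poly_Mapping.single v 1" "side v"] by simp

lemma side_inj: "side u = side v \<Longrightarrow> u = v"
proof (rule ccontr)
  assume s: "side u = side v" and ne: "u \<noteq> v"
  have "lookup (side u) u = D u - 2" "lookup (side v) u = D u - 1"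
    using ne by (simp_all add: side_def lookup_minus lookup_corner lookup_single)
  then show False using s D_gt[of u] by simp
qed

lemma reduced_corner:
  assumes "is_reduced D m" "mdeg m = Suc (Suc t)"
  shows "m = socle_exp"
proof -
  obtain k where k: "socle_exp = m + k" "mdeg socle_exp = mdeg m + mdeg k"
    using reduced_complement[OF assms(1)] by blast
  then have "mdeg k = 0" using assms(2) mdeg_corner by linarith
  then have "k = 0" by (rule iffD1[OF mdeg_eq_0_iff])
  then show ?thesis using k(1) by simp
qed

lemma reduced_side:
  assumes "is_reduced D m" "mdeg m = Suc t"
  shows "\<exists>v. m = side v"
proof -
  obtain k where k: "socle_exp = m + k" "mdeg k = 1"
    using reduced_complement[OF assms(1)] mdeg_corner assms(2) by auto
  then obtain v where "k = Poly_Mapping.single v 1" using mdeg_eq_1 by blast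
  then show ?thesis using k(1) unfolding side_def by (metis add_diff_cancel_right')
qed

lemma e_gens: "i \<in> {n+1..2*n-2} \<Longrightarrow> e i = Suc t"
  using e(2) d_eq by simp

lemma tuple_forms: "F \<in> form_tuples (2*n-2) e \<Longrightarrow> i \<in> {1..2*n-2} \<Longrightarrow> F i \<in> forms (e i)"
  unfolding form_tuples_def by (rule PiE_mem)

lemma form_system_sys:
  assumes "F \<in> form_tuples (2*n-2) e"
  shows "form_system (sys F) D"
proof
  show "0 < D v" for v using D_gt[of v] by simp
  show "F (idx v) \<in> forms (D v)" for v
    using tuple_forms[OF assms, of "idx v"] idx_range[of v] e(1)[of "idx v"] n3 by (auto simp: D_def)
qed

lemma special_sys: "special (idx v) = mon (Poly_Mapping.single v (D v))"
  using idx_range[of v] n3 by (auto simp: special_def \<iota>_idx D_def)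

lemma special_gens: "j \<in> {1..n-2} \<Longrightarrow> special (n + j) = mon (side (\<iota> j))"
  by (auto simp: special_def)

lemma special_tuple: "special \<in> form_tuples (2*n-2) e"
  unfolding form_tuples_def special_def restrict_PiE_iff
proof
  fix i assume i: "i \<in> {1..2*n-2}"
  show "(if i \<le> n then mon (Poly_Mapping.single (\<iota> i) (deg i)) else mon (side (\<iota> (i - n)))) \<in> forms (e i)"
    using i e(1)[of i] e_gens[of i] by (auto intro!: forms_mon simp: mdeg_side)
qed

lemma std_form_special: "std_form (sys special) D m = mon m"
proof -
  interpret form_system "sys special" D
    by (rule form_system_sys[OF special_tuple])
  show ?thesis
    using pivot_add[of m] by (simp add: std_form_def special_sys mon_add[symmetric] add.commute)
qed

section \<open>Degreewise spanning conditions near the special tuple\<close>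

lemma poly_fun_std_form: "poly_fun (\<lambda>F. lookup (std_form (sys F) D m) m')"
  by (cases "is_reduced D m") (simp_all add: std_form_def poly_fun_const poly_fun_mon_mult)

lemma std_form_forms: "F \<in> form_tuples (2*n-2) e \<Longrightarrow> m \<in> mons t' \<Longrightarrow> std_form (sys F) D m \<in> forms t'"
  for F :: "nat \<Rightarrow> ('n, 'k::field) mpoly"
  using form_system.std_vec_forms[OF form_system_sys, of F m] by (simp add: mons_def)

lemma sys_in_ideal: "F (idx v) \<in> ideal F"
  using idx_range[of v] n3 by (intro ideal_gen_gen imageI) auto

lemma std_form_in_ideal: "\<not> is_reduced D m \<Longrightarrow> std_form (sys F) D m \<in> ideal F"
  unfolding std_form_def by (simp only: if_False ideal_gen_mult sys_in_ideal)

lemma ideal_eq: "ideal F = ideal_gen (range (sys F) \<union> F ` {n+1..2*n-2})"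
proof -
  have "idx ` UNIV = {1..n}"
    using idx_range idx_\<iota> by (metis (no_types, opaque_lifting) UNIV_I image_subset_iff rangeI subsetI subset_antisym)
  then have "range (sys F) = F ` {1..n}"
    by (metis image_image)
  moreover have "{1..2*n-2} = {1..n} \<union> {n+1..2*n-2}" using n3 by auto
  ultimately show ?thesis by (simp only: image_Un)
qed

lemma open_std_span:
  "open_special (\<lambda>F. \<forall>t'\<in>A. \<forall>q\<in>forms t'. \<exists>c. q = (\<Sum>m\<in>mons t'. cst (c m) * std_form (sys F) D m))"
  if "finite A"
  by (intro open_near_ball that open_near_spanning poly_fun_std_form std_form_special std_form_forms)

text \<open>The corner is the only reduced monomial of this degree. Replacing it by
  \<open>var (\<iota> 1) * F (n + 1)\<close>, which equals it at the special tuple, leaves a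
  spanning family inside the ideal.\<close>

lemma open_top_degree: "open_special (\<lambda>F. forms (Suc (Suc t)) \<subseteq> ideal F)"
proof (rule open_near_mono)
  define V where "V F m = (if m = socle_exp then var (\<iota> 1) * F (n + 1) else std_form (sys F) D m)"
    for F :: "nat \<Rightarrow> ('n, 'k::field) mpoly" and m
  show "open_special (\<lambda>F :: nat \<Rightarrow> ('n, 'k) mpoly. \<forall>q\<in>forms (Suc (Suc t)). \<exists>c. q = (\<Sum>m\<in>mons (Suc (Suc t)). cst (c m) * V F m))"
  proof (rule open_near_spanning)
    show "poly_fun (\<lambda>F. lookup (V F m) m')" for m m'
      by (cases "m = socle_exp") (simp_all only: V_def simp_thms if_True if_False poly_fun_std_form poly_fun_mon_mult)
    show "V special m = mon m" for m
    proof (cases "m = socle_exp")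
      case True
      have "1 \<in> {1..n-2}" using n3 by simp
      then have "(special (n + 1) :: ('n, 'k) mpoly) = mon (side (\<iota> 1))" by (rule special_gens)
      then have "V special m = var (\<iota> 1) * mon (side (\<iota> 1))"
        using True by (simp add: V_def)
      then show ?thesis
        using True side_add[of "\<iota> 1"] by (simp only: mon_add[symmetric])
    qed (simp add: V_def std_form_special)
    fix F :: "nat \<Rightarrow> ('n, 'k) mpoly" and m :: "'n \<Rightarrow>\<^sub>0 nat"
    assume F: "F \<in> form_tuples (2*n-2) e" and m: "m \<in> mons (Suc (Suc t))"
    have "F (n + 1) \<in> forms (Suc t)"
      using tuple_forms[OF F, of "n + 1"] e_gens[of "n + 1"] n3 by simp
    then have "var (\<iota> 1) * F (n + 1) \<in> forms (1 + Suc t)"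
      by (intro forms_mult forms_var)
    then show "V F m \<in> forms (Suc (Suc t))"
      using std_form_forms[OF F m] by (simp add: V_def)
  qed
  fix F :: "nat \<Rightarrow> ('n, 'k) mpoly"
  assume sp: "\<forall>q\<in>forms (Suc (Suc t)). \<exists>c. q = (\<Sum>m\<in>mons (Suc (Suc t)). cst (c m) * V F m)"
  have "V F m \<in> ideal F" if "m \<in> mons (Suc (Suc t))" for m
  proof (cases "m = socle_exp")
    case True
    have "F (n + 1) \<in> ideal F" using n3 by (intro ideal_gen_gen imageI) simp
    then show ?thesis unfolding V_def True by (simp only: simp_thms if_True ideal_gen_mult)
  next
    case False
    then have "\<not> is_reduced D m" using reduced_corner that by (auto simp: mons_def)
    then show ?thesis using False unfolding V_def by (simp only: simp_thms if_False std_form_in_ideal)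
  qed
  then have *: "(\<Sum>m\<in>mons (Suc (Suc t)). cst (c m) * V F m) \<in> ideal F" for c
    by (intro ideal_gen_sum ideal_gen_mult)
  show "forms (Suc (Suc t)) \<subseteq> ideal F"
  proof
    fix q :: "('n, 'k) mpoly" assume "q \<in> forms (Suc (Suc t))"
    then obtain c where "q = (\<Sum>m\<in>mons (Suc (Suc t)). cst (c m) * V F m)" using sp by blast
    then show "q \<in> ideal F" using * by (simp only:)
  qed
qed

text \<open>The reduced monomials of this degree are the \<open>n\<close> sides. The added
  generators replace the first \<open>n - 2\<close> of them, and the last two span a
  complement.\<close>

lemma open_codim_two:
  "open_special (\<lambda>F. \<forall>q\<in>forms (Suc t). \<exists>c1 c2.
     q - (cst c1 * mon (side (\<iota> (n - 1))) + cst c2 * mon (side (\<iota> n))) \<in> ideal F)"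
proof (rule open_near_mono)
  define J where "J m = {j \<in> {1..n-2}. m = side (\<iota> j)}" for m
  define V where "V F m = (if J m \<noteq> {} then F (n + (SOME j. j \<in> J m)) else std_form (sys F) D m)"
    for F :: "nat \<Rightarrow> ('n, 'k::field) mpoly" and m
  have J: "(SOME j. j \<in> J m) \<in> {1..n-2} \<and> m = side (\<iota> (SOME j. j \<in> J m))" if "J m \<noteq> {}" for m
    using some_in_eq[of "J m"] that by (simp add: J_def)
  have range: "n + j \<in> {n+1..2*n-2}" if "j \<in> {1..n-2}" for j
    using that n3 by auto
  show "open_special (\<lambda>F :: nat \<Rightarrow> ('n, 'k) mpoly. \<forall>q\<in>forms (Suc t). \<exists>c. q = (\<Sum>m\<in>mons (Suc t). cst (c m) * V F m))"
  proof (rule open_near_spanning)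
    show "poly_fun (\<lambda>F. lookup (V F m) m')" for m m'
      by (cases "J m \<noteq> {}") (simp_all only: V_def simp_thms if_True if_False poly_fun_std_form poly_fun_coord)
    show "V special m = mon m" for m
    proof (cases "J m \<noteq> {}")
      case True
      then have "(special (n + (SOME j. j \<in> J m)) :: ('n, 'k) mpoly) = mon (side (\<iota> (SOME j. j \<in> J m)))"
        using J by (intro special_gens) blast
      also have "\<dots> = mon m" using J[OF True] by metis
      finally show ?thesis using True by (simp add: V_def)
    qed (simp add: V_def std_form_special)
    fix F :: "nat \<Rightarrow> ('n, 'k) mpoly" and m :: "'n \<Rightarrow>\<^sub>0 nat"
    assume F: "F \<in> form_tuples (2*n-2) e" and m: "m \<in> mons (Suc t)"
    have "F (n + j) \<in> forms (Suc t)" if "j \<in> {1..n-2}" for j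
      using tuple_forms[OF F, of "n + j"] e_gens[OF range[OF that]] range[OF that] by auto
    then show "V F m \<in> forms (Suc t)"
      using std_form_forms[OF F m] J[of m] by (simp add: V_def)
  qed
  fix F :: "nat \<Rightarrow> ('n, 'k) mpoly"
  assume sp: "\<forall>q\<in>forms (Suc t). \<exists>c. q = (\<Sum>m\<in>mons (Suc t). cst (c m) * V F m)"
  let ?m1 = "side (\<iota> (n - 1))" and ?m2 = "side (\<iota> n)"
  have "n - 1 \<in> {1..n}" "n \<in> {1..n}" "n - 1 \<noteq> n" using n3 by auto
  then have "\<iota> (n - 1) \<noteq> \<iota> n" using idx_\<iota> by metis
  then have ne: "?m1 \<noteq> ?m2" using side_inj by blast
  have V: "V F m \<in> ideal F \<or> (m \<in> {?m1, ?m2} \<and> V F m = mon m)" if m: "m \<in> mons (Suc t)" for m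
  proof (cases "J m \<noteq> {}")
    case True
    then have "V F m = F (n + (SOME j. j \<in> J m))" by (simp add: V_def)
    moreover have "n + (SOME j. j \<in> J m) \<in> {1..2*n-2}" using range J[OF True] by fastforce
    ultimately show ?thesis by (simp only: ideal_gen_gen imageI simp_thms)
  next
    case False
    show ?thesis
    proof (cases "is_reduced D m")
      case True
      then obtain v where v: "m = side v" using reduced_side m by (auto simp: mons_def)
      have "idx v \<notin> {1..n-2}" using False v \<iota>_idx[of v] by (auto simp: J_def)
      then have "idx v = n - 1 \<or> idx v = n" using idx_range[of v] by auto
      then have "v = \<iota> (n - 1) \<or> v = \<iota> n" using \<iota>_idx[of v] by metis
      moreover have "V F m = mon m" using False True by (simp add: V_def std_form_def)
      ultimately show ?thesis using v by blast
    next
      case nr: False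
      then show ?thesis using False unfolding V_def by (simp only: if_False std_form_in_ideal simp_thms)
    qed
  qed
  show "\<forall>q\<in>forms (Suc t). \<exists>c1 c2. q - (cst c1 * mon ?m1 + cst c2 * mon ?m2) \<in> ideal F"
  proof
    fix q :: "('n, 'k) mpoly" assume "q \<in> forms (Suc t)"
    then obtain c where c: "q = (\<Sum>m\<in>mons (Suc t). cst (c m) * V F m)" using sp by blast
    \<comment> \<open>Only vectors outside the ideal keep their coefficient; by \<open>V\<close>
      these are among the last two sides.\<close>
    define c' where "c' m = (if V F m \<in> ideal F then 0 else c m)" for m
    have m12: "{?m1, ?m2} \<subseteq> mons (Suc t)" by (simp add: mons_def mdeg_side)
    have "(\<Sum>m\<in>mons (Suc t). cst (c' m) * mon m) = (\<Sum>m\<in>{?m1, ?m2}. cst (c' m) * mon m :: ('n, 'k) mpoly)"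
      using V by (intro sum.mono_neutral_right m12) (auto simp: c'_def)
    also have "\<dots> = cst (c' ?m1) * mon ?m1 + cst (c' ?m2) * mon ?m2"
      using ne by simp
    finally have "q - (cst (c' ?m1) * mon ?m1 + cst (c' ?m2) * mon ?m2) =
        (\<Sum>m\<in>mons (Suc t). cst (c m) * V F m - cst (c' m) * mon m)"
      unfolding c sum_subtractf by simp
    also have "\<dots> \<in> ideal F"
    proof (rule ideal_gen_sum)
      fix m :: "'n \<Rightarrow>\<^sub>0 nat" assume m: "m \<in> mons (Suc t)"
      show "cst (c m) * V F m - cst (c' m) * mon m \<in> ideal F"
      proof (cases "V F m \<in> ideal F")
        case True
        then have "cst (c m) * V F m \<in> ideal F" by (rule ideal_gen_mult)
        then show ?thesis unfolding c'_def using True by (simp only: if_True cst_simps mult_zero_left diff_zero)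
      next
        case False
        then have "V F m = mon m" using V[OF m] by blast
        then have "cst (c m) * V F m - cst (c' m) * mon m = 0"
          unfolding c'_def using False by (simp only: if_False diff_self)
        then show ?thesis by (simp only: ideal_gen_0)
      qed
    qed
    finally show "\<exists>c1 c2. q - (cst c1 * mon ?m1 + cst c2 * mon ?m2) \<in> ideal F" by blast
  qed
qed

end

section \<open>The pairing with quadrics, absence of Koszul syzygies, and both copies\<close>

context ghost_data
begin

text \<open>Since \<open>2 < D v\<close>, all corner exponents are at least two, so every quadratic
  monomial divides the corner.\<close>

lemma quadric_complement: "p \<in> mons 2 \<Longrightarrow> p + (socle_exp - p) = socle_exp"
proof (rule exponent_diff)
  fix v assume "p \<in> mons 2"
  then have "lookup p v \<le> 2" using lookup_le_mdeg[of p v] by (simp add: mons_def)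
  then show "lookup p v \<le> lookup socle_exp v" using D_gt[of v] by (simp add: lookup_corner)
qed

text \<open>\<open>Hom(R\<^sub>2, R\<^sub>s)\<close>, \<open>s = mdeg socle_exp\<close>, is spanned by \<open>Hom(R\<^sub>2, J\<^sub>s)\<close> and multiplications by forms of
  degree \<open>s - 2\<close>. As the residue vanishes on \<open>J\<close>, its composites with the latter are all the
  functionals on \<open>R\<^sub>2\<close>. In this form no coordinates of the residue enter.\<close>

lemma open_perfect_pairing:
  "open_special (\<lambda>F. surj_form_system (sys F) D \<longrightarrow>
     (\<forall>l. \<exists>a\<in>forms t. \<forall>m\<in>mons 2. surj_form_system.residue (sys F) D (a * mon m) = l m))"
proof (rule open_near_mono)
  let ?s = "Suc (Suc t)"
  \<comment> \<open>The column \<open>(p, m)\<close> is a homomorphism on quadrics, and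
    \<open>W F p' p m\<close> is its value at \<open>p'\<close>: multiplication by the complement of
    \<open>p\<close> if \<open>m\<close> is the corner, and otherwise the map sending
    \<open>p\<close> to a multiple of some generator and the other quadratic monomials to
    zero.\<close>
  define W where "W F p' p m = (if m = socle_exp then mon (socle_exp - p + p')
      else if p = p' then std_form (sys F) D m else 0)"
    for F :: "nat \<Rightarrow> ('n, 'k::field) mpoly" and p' p m
  define A where "A F x y = lookup (W F (fst x) (fst y) (snd y)) (snd x)"
    for F :: "nat \<Rightarrow> ('n, 'k) mpoly" and x y
  let ?S = "(mons 2 :: ('n \<Rightarrow>\<^sub>0 nat) set) \<times> (mons ?s :: ('n \<Rightarrow>\<^sub>0 nat) set)"
  have socle_exp: "socle_exp \<in> mons ?s" by (simp add: mons_def mdeg_corner)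
  show "open_special (\<lambda>F :: nat \<Rightarrow> ('n, 'k) mpoly. spans_on ?S (A F))"
  proof (rule open_near_spans_on)
    show "poly_fun (\<lambda>F. A F x y)" for x y
      by (cases "snd y = socle_exp"; cases "fst y = fst x")
        (simp_all add: A_def W_def poly_fun_std_form poly_fun_const)
    have "\<exists>c. \<forall>x\<in>?S. (\<Sum>y\<in>?S. A special x y * c y) = z x" for z :: "_ \<Rightarrow> 'k"
    proof -
      define \<delta> where "\<delta> p' p m' = (if socle_exp - p + p' = m' then z (p, socle_exp) else 0)" for p' p m'
      \<comment> \<open>Back substitution: off the corner the columns are unit vectors, so the stray
        entries \<open>\<delta>\<close> of the multiplication columns are subtracted there.\<close>
      define c where "c y = (if snd y = socle_exp then z y
          else z y - (\<Sum>p\<in>mons 2. \<delta> (fst y) p (snd y)))" for y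
      have "(\<Sum>y\<in>?S. A special (p', m') y * c y) = z (p', m')"
        if p': "p' \<in> mons 2" and m': "m' \<in> mons ?s" for p' m'
      proof -
        have inner: "(\<Sum>m\<in>mons ?s. A special (p', m') (p, m) * c (p, m)) =
            \<delta> p' p m' + (if p = p' then if m' = socle_exp then 0 else c (p', m') else 0)" for p
        proof -
          have "(\<Sum>m\<in>mons ?s - {socle_exp}. A special (p', m') (p, m) * c (p, m)) =
              (\<Sum>m\<in>mons ?s - {socle_exp}. if m = m' then (if p = p' then c (p', m') else 0) else 0)"
            by (rule sum.cong) (auto simp: A_def W_def std_form_special lookup_mon)
          also have "\<dots> = (if p = p' then if m' = socle_exp then 0 else c (p', m') else 0)"
            using m' by (simp add: sum.delta')
          finally have "(\<Sum>m\<in>mons ?s - {socle_exp}. A special (p', m') (p, m) * c (p, m)) =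
              (if p = p' then if m' = socle_exp then 0 else c (p', m') else 0)" .
          moreover have "A special (p', m') (p, socle_exp) * c (p, socle_exp) = \<delta> p' p m'"
            by (simp add: A_def W_def lookup_mon c_def \<delta>_def)
          ultimately show ?thesis
            by (subst sum.remove[OF finite_mons socle_exp]) simp
        qed
        have "(\<Sum>y\<in>?S. A special (p', m') y * c y) =
            (\<Sum>p\<in>mons 2. \<Sum>m\<in>mons ?s. A special (p', m') (p, m) * c (p, m))"
          by (simp add: sum.cartesian_product)
        also have "\<dots> = (\<Sum>p\<in>mons 2. \<delta> p' p m') + (if m' = socle_exp then 0 else c (p', m'))"
          unfolding inner sum.distrib using p' by (simp add: sum.delta)
        also have "\<dots> = z (p', m')"
        proof (cases "m' = socle_exp")
          case True
          have "socle_exp - p + p' = socle_exp \<longleftrightarrow> p = p'" if "p \<in> mons 2" for p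
            using quadric_complement[OF that] by (metis add.commute add_left_cancel)
          then have "(\<Sum>p\<in>mons 2. \<delta> p' p m') = (\<Sum>p\<in>mons 2. if p = p' then z (p, socle_exp) else 0)"
            unfolding \<delta>_def True by (intro sum.cong) simp_all
          then show ?thesis using p' True by simp
        next
          case False
          then show ?thesis by (simp add: c_def)
        qed
        finally show ?thesis .
      qed
      then show ?thesis by (intro exI[of _ c]) auto
    qed
    then show "spans_on ?S (A special)" unfolding spans_on_def by blast
  qed simp
  fix F :: "nat \<Rightarrow> ('n, 'k) mpoly"
  assume F: "F \<in> form_tuples (2*n-2) e" and sp: "spans_on ?S (A F)"
  show "surj_form_system (sys F) D \<longrightarrow>
     (\<forall>l. \<exists>a\<in>forms t. \<forall>m\<in>mons 2. surj_form_system.residue (sys F) D (a * mon m) = l m)"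
  proof (intro impI allI)
    fix l :: "('n \<Rightarrow>\<^sub>0 nat) \<Rightarrow> 'k"
    assume "surj_form_system (sys F) D"
    then interpret surj_form_system "sys F" D .
    \<comment> \<open>The target is the homomorphism \<open>p' \<mapsto> l p' * x^corner\<close>,
      whose residue is \<open>l\<close>.\<close>
    obtain c where c: "\<forall>x\<in>?S. (\<Sum>y\<in>?S. A F x y * c y) = (if snd x = socle_exp then l (fst x) else 0)"
      using sp[unfolded spans_on_def, rule_format, of "\<lambda>x. if snd x = socle_exp then l (fst x) else 0"] by blast
    define a where "a = (\<Sum>p\<in>mons 2. cst (c (p, socle_exp)) * mon (socle_exp - p))"
    have compl: "mdeg (socle_exp - p) = t" if "p \<in> mons 2" for p
      using arg_cong[OF quadric_complement[OF that], of mdeg] that mdeg_corner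
      by (simp add: mdeg_add mons_def)
    have "a \<in> forms t"
      unfolding a_def by (intro forms_sum forms_cst_mult forms_mon compl)
    moreover have "residue (a * mon p') = l p'" if p': "p' \<in> mons 2" for p'
    proof -
      have W_forms: "W F p' p m \<in> forms ?s" if "p \<in> mons 2" "m \<in> mons ?s" for p m
        using std_form_forms[OF F that(2)] compl[OF that(1)] p'
        by (auto simp: W_def mdeg_add mons_def intro!: forms_mon)
      have "(\<Sum>y\<in>?S. cst (c y) * W F p' (fst y) (snd y)) = cst (l p') * mon socle_exp"
      proof (rule forms_eqI)
        show "(\<Sum>y\<in>?S. cst (c y) * W F p' (fst y) (snd y)) \<in> forms ?s"
          by (intro forms_sum forms_cst_mult W_forms) auto
        show "cst (l p') * mon socle_exp \<in> forms ?s"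
          by (intro forms_cst_mult forms_mon mdeg_corner)
        fix m' :: "'n \<Rightarrow>\<^sub>0 nat" assume m': "m' \<in> mons ?s"
        have "lookup (\<Sum>y\<in>?S. cst (c y) * W F p' (fst y) (snd y)) m' = (\<Sum>y\<in>?S. A F (p', m') y * c y)"
          by (simp add: lookup_sum A_def mult.commute)
        also have "\<dots> = (if m' = socle_exp then l p' else 0)"
          using c p' m' by simp
        finally show "lookup (\<Sum>y\<in>?S. cst (c y) * W F p' (fst y) (snd y)) m' = lookup (cst (l p') * mon socle_exp) m'"
          by (simp add: lookup_mon)
      qed
      then have "l p' = residue (\<Sum>y\<in>?S. cst (c y) * W F p' (fst y) (snd y))"
        by (simp add: residue_cst_mult residue_corner)
      also have "\<dots> = (\<Sum>p\<in>mons 2. \<Sum>m\<in>mons ?s. c (p, m) * residue (W F p' p m))"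
        by (simp add: residue_sum residue_cst_mult sum.cartesian_product case_prod_unfold)
      also have "\<dots> = (\<Sum>p\<in>mons 2. c (p, socle_exp) * residue (mon (socle_exp - p) * mon p'))"
      proof (rule sum.cong[OF refl])
        fix p :: "'n \<Rightarrow>\<^sub>0 nat"
        \<comment> \<open>Columns other than multiplications take values in the ideal of the system,
          where the residue vanishes; only the part collected in \<open>a\<close> is left.\<close>
        have "c (p, m) * residue (W F p' p m) = 0" if "m \<in> mons ?s - {socle_exp}" for m
        proof -
          have "\<not> is_reduced D m" using that reduced_corner by (auto simp: mons_def)
          then have "residue (std_form (sys F) D m) = 0"
            by (simp add: std_form_def mult.commute[of _ "F _"] residue_f_mult)
          then show ?thesis using that by (simp add: W_def)
        qed
        then have "(\<Sum>m\<in>mons ?s - {socle_exp}. c (p, m) * residue (W F p' p m)) = 0"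
          by (intro sum.neutral) blast
        moreover have "W F p' p socle_exp = mon (socle_exp - p) * mon p'"
          by (simp add: W_def mon_add)
        ultimately show "(\<Sum>m\<in>mons ?s. c (p, m) * residue (W F p' p m)) =
            c (p, socle_exp) * residue (mon (socle_exp - p) * mon p')"
          by (simp only: sum.remove[OF finite_mons socle_exp] add_0_right)
      qed
      also have "\<dots> = residue (a * mon p')"
        by (simp add: a_def sum_distrib_right residue_sum residue_cst_mult mult.assoc)
      finally show ?thesis ..
    qed
    ultimately show "\<exists>a\<in>forms t. \<forall>m\<in>mons 2. residue (a * mon m) = l m" by blast
  qed
qed

text \<open>The first \<open>n\<close> degrees add up to \<open>d\<close>. Any other choice contains
  an added generator and \<open>n - 1\<close> further ones of degree at least 3, so its sum is at
  least \<open>d - n - 1 + 3 * (n - 1)\<close>, which exceeds \<open>d - 2\<close>.\<close>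

lemma koszul_no_copies: "copies (koszul (2*n-2) e F) n (d - 2) = {}"
proof -
  have "(\<Sum>j\<in>S. e j) \<noteq> d - 2" if S: "S \<subseteq> {1..2*n-2}" "card S = n" for S
  proof (cases "S \<subseteq> {1..n}")
    case True
    then have "S = {1..n}" using S(2) by (intro card_subset_eq) simp_all
    then have "(\<Sum>j\<in>S. e j) = d" unfolding d by (simp add: e(1))
    then show ?thesis using d_eq by simp
  next
    case False
    then obtain j where j: "j \<in> S" "j \<in> {n+1..2*n-2}" using S(1) by force
    have fin: "finite S" using S(1) by (rule finite_subset) simp
    have "3 \<le> e i" if "i \<in> S" for i
    proof (cases "i \<le> n")
      case True
      then show ?thesis using that S(1) e(1)[of i] deg_gt[of i] by auto
    next
      case False
      then show ?thesis using that S(1) e_gens[of i] t_ge by auto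
    qed
    then have "(\<Sum>i\<in>S - {j}. 3) \<le> (\<Sum>i\<in>S - {j}. e i)"
      by (intro sum_mono) simp
    then have "3 * (n - 1) + Suc t \<le> (\<Sum>i\<in>S. e i)"
      using fin j S(2) e_gens[OF j(2)] by (simp add: sum.remove[of S j] mult.commute)
    then show ?thesis using d_eq n3 by linarith
  qed
  then show ?thesis by (auto simp: copies_def koszul_def)
qed

text \<open>The case \<open>D = 1\<close> of the general construction: every standard vector is a
  monomial, and none of degree one is reduced.\<close>

lemma variables_regular: "regular_sequence n (\<lambda>i. var (\<iota> i) :: ('n, 'k::field) mpoly)"
proof -
  interpret form_system "var :: 'n \<Rightarrow> ('n, 'k) mpoly" "\<lambda>_. 1"
    by standard (simp, rule forms_var)
  have std: "std_vec m = (mon m :: ('n, 'k) mpoly)" for m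
    using pivot_add[of m] by (simp add: std_form_def mon_add[symmetric] add.commute)
  have "surj subst_f"
  proof (rule surj_subst_f)
    show "\<exists>c. q = (\<Sum>m\<in>mons t. cst (c m) * std_vec m)" if "q \<in> forms t" for t q
      unfolding std using forms_expand[OF that] by blast
    show "\<not> reduced m" if m: "mdeg m = Suc 0" for m
    proof
      assume red: "reduced m"
      obtain v where "m = Poly_Mapping.single v 1" using mdeg_eq_1[of m] m by auto
      then have "lookup m v = 1" by simp
      then show False using red by (auto simp: is_reduced_def)
    qed
  qed
  then interpret surj_form_system "var :: 'n \<Rightarrow> ('n, 'k) mpoly" "\<lambda>_. 1"
    by unfold_locales
  show ?thesis by (rule regular_sequence_f[OF \<iota>]) simp
qed

lemma maximal_ideal:
  fixes p :: "('n, 'k::field) mpoly"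
  assumes "lookup p 0 = 0"
  shows "p \<in> ideal_gen ((\<lambda>i. var (\<iota> i)) ` {1..n})"
proof -
  have "mon m \<in> ideal_gen ((\<lambda>i. var (\<iota> i) :: ('n, 'k) mpoly) ` {1..n})" if m: "m \<in> keys p" for m
  proof -
    have "m \<noteq> 0" using m assms by (auto simp: in_keys_iff)
    then obtain v where "lookup m v \<noteq> 0" by (metis poly_mapping_eqI lookup_zero)
    then have "Poly_Mapping.single v 1 + (m - Poly_Mapping.single v 1) = m"
      by (intro exponent_diff_single) simp
    then have "mon m = mon (m - Poly_Mapping.single v 1) * (var v :: ('n, 'k) mpoly)"
      by (metis mon_add mult.commute)
    moreover have "(var v :: ('n, 'k) mpoly) \<in> (\<lambda>i. var (\<iota> i)) ` {1..n}"
      using idx_range[of v] \<iota>_idx[of v] by (metis imageI)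
    ultimately show ?thesis by (simp only: ideal_gen_mult ideal_gen_gen)
  qed
  then have "(\<Sum>m\<in>keys p. cst (lookup p m) * mon m) \<in> ideal_gen ((\<lambda>i. var (\<iota> i)) ` {1..n})"
    by (intro ideal_gen_sum ideal_gen_mult)
  then show ?thesis using mpoly_expand[of "keys p" p] by simp
qed

text \<open>The socle element is a 0-cocycle of degree \<open>t\<close> and the second class a
  1-cocycle of degree \<open>Suc t\<close>; the shifts \<open>t + n\<close> and
  \<open>Suc t + (n - 1)\<close> are both \<open>d - 2\<close>.\<close>

lemma ghost_term_of_generators:
  fixes F :: "nat \<Rightarrow> ('n, 'k::field) mpoly" and C :: "('b, ('n, 'k) mpoly) graded_seq"
  assumes F: "F \<in> form_tuples (2*n-2) e" and surj: "surj_form_system (sys F) D"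
    and top: "forms (Suc (Suc t)) \<subseteq> ideal F"
    and codim: "\<forall>q\<in>forms (Suc t). \<exists>c1 c2.
      q - (cst c1 * mon (side (\<iota> (n - 1))) + cst c2 * mon (side (\<iota> n))) \<in> ideal F"
    and perfect: "\<forall>l. \<exists>a\<in>forms t. \<forall>m\<in>mons 2. surj_form_system.residue (sys F) D (a * mon m) = l m"
    and C: "graded_free_resolution (ideal F) C"
  shows "ghost_term C (n - 1) (d - 2)"
proof -
  interpret surj_form_system "sys F" D by (rule surj)
  let ?x = "\<lambda>i. var (\<iota> i) :: ('n, 'k) mpoly"
  have "(\<exists>a\<in>forms t. a \<notin> ideal F \<and> (\<forall>v. var v * a \<in> ideal F)) \<and>
    (\<exists>b. (\<forall>v. b v \<in> forms (Suc t)) \<and> (\<nexists>c. \<forall>v. b v - var v * c \<in> ideal F))"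
  proof (rule socle_element_and_cocycle[where G = F and J = "{n+1..2*n-2}"])
    show "F i \<in> forms (Suc t)" if "i \<in> {n+1..2*n-2}" for i
      using tuple_forms[OF F, of i] that e_gens[OF that] by simp
    show "mon (side (\<iota> (n - 1))) \<in> forms (Suc t)" "mon (side (\<iota> n)) \<in> forms (Suc t)"
      by (simp_all add: forms_mon mdeg_side)
  qed (use card n3 mdeg_corner ideal_eq perfect codim in auto)
  then obtain a b where a: "a \<in> forms t" "a \<notin> ideal F" "\<And>v. var v * a \<in> ideal F"
    and b: "\<And>v. b v \<in> forms (Suc t)" "\<nexists>c. \<forall>v. b v - var v * c \<in> ideal F"
    by blast
  have x: "?x i \<in> forms 1" for i by (rule forms_var)
  have kdiff_singleton: "kdiff ?x g {i} = ?x i * g {}" for g i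
  proof -
    have "{u. u = i \<and> u < i} = {}" by auto
    show ?thesis by (simp add: kdiff_def \<open>{u. u = i \<and> u < i} = {}\<close>)
  qed
  have "copies C (n - 0) (t + (n - 0)) \<noteq> {}"
  proof (rule koszul_cocycle_imp_copies[OF C variables_regular x maximal_ideal, where b = "\<lambda>_. a"])
    show "kdiff ?x (\<lambda>_. a) S \<in> ideal F" if cS: "card S = Suc 0" for S
    proof -
      obtain i where "S = {i}" using cS by (auto simp: card_Suc_eq)
      then show ?thesis using a(3) by (simp only: kdiff_singleton)
    qed
    have "kdiff ?x c {} = 0" for c by (simp add: kdiff_def)
    then show "\<nexists>c. \<forall>S. S \<subseteq> {1..n} \<and> card S = 0 \<longrightarrow> a - kdiff ?x c S \<in> ideal F"
      using a(2) by (metis card.empty diff_zero empty_subsetI)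
  qed (use a(1) in simp_all)
  moreover have "copies C (n - 1) (Suc t + (n - 1)) \<noteq> {}"
  proof (rule koszul_cocycle_imp_copies[OF C variables_regular x maximal_ideal, where b = "\<lambda>S. b (\<iota> (Min S))"])
    show "b (\<iota> (Min S)) \<in> forms (Suc t)" for S by (rule b)
    \<comment> \<open>Every such family is a cocycle, because its differential has degree
      \<open>Suc (Suc t)\<close>, where the ideal is everything. \<open>Min\<close> extracts the
      index from a singleton.\<close>
    show "kdiff ?x (\<lambda>S. b (\<iota> (Min S))) S \<in> ideal F" for S
    proof -
      have "graded_entry (Suc (Suc t)) 0 (kdiff ?x (\<lambda>S. b (\<iota> (Min S))) S)"
        using b(1) by (intro graded_entry_kdiff x) (simp add: graded_entry_def forms_def)
      then have "kdiff ?x (\<lambda>S. b (\<iota> (Min S))) S \<in> forms (Suc (Suc t))"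
        by (simp add: graded_entry_def forms_def)
      then show ?thesis using top by blast
    qed
    show "\<nexists>c. \<forall>S. S \<subseteq> {1..n} \<and> card S = 1 \<longrightarrow> b (\<iota> (Min S)) - kdiff ?x c S \<in> ideal F"
    proof
      assume "\<exists>c. \<forall>S. S \<subseteq> {1..n} \<and> card S = 1 \<longrightarrow> b (\<iota> (Min S)) - kdiff ?x c S \<in> ideal F"
      then obtain c where c: "\<And>S. S \<subseteq> {1..n} \<Longrightarrow> card S = 1 \<Longrightarrow>
          b (\<iota> (Min S)) - kdiff ?x c S \<in> ideal F"
        by blast
      have "b v - var v * c {} \<in> ideal F" for v
      proof -
        have "b (\<iota> (Min {idx v})) - kdiff ?x c {idx v} \<in> ideal F"
          by (rule c) (use idx_range[of v] in auto)
        then show ?thesis unfolding kdiff_singleton Min_singleton \<iota>_idx .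
      qed
      then show False using b(2) by blast
    qed
  qed (use n3 in auto)
  moreover have "t + (n - 0) = d - 2" "Suc t + (n - 1) = d - 2" "Suc (n - 1) = n - 0"
    using d_eq n3 by simp_all
  ultimately show ?thesis unfolding ghost_term_def by metis
qed

lemma open_ghost_term:
  "open_special (\<lambda>F :: nat \<Rightarrow> ('n, 'k::field) mpoly. regular_sequence n F \<and>
     (\<forall>C :: ('b, ('n, 'k) mpoly) graded_seq.
        minimal_graded_free_resolution (ideal F) C \<longrightarrow> non_koszul_ghost_term (2*n-2) e F C (n-1) (d-2)))"
proof (rule open_near_mono)
  \<comment> \<open>The spanning condition runs one degree past the corner, to a degree without
    reduced monomials, as \<open>surj_subst_f\<close> requires.\<close>
  show "open_special (\<lambda>F :: nat \<Rightarrow> ('n, 'k) mpoly.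
      (\<forall>t'\<in>{..Suc (Suc (Suc t))}. \<forall>q\<in>forms t'. \<exists>c. q = (\<Sum>m\<in>mons t'. cst (c m) * std_form (sys F) D m)) \<and>
      forms (Suc (Suc t)) \<subseteq> ideal F \<and>
      (\<forall>q\<in>forms (Suc t). \<exists>c1 c2.
        q - (cst c1 * mon (side (\<iota> (n - 1))) + cst c2 * mon (side (\<iota> n))) \<in> ideal F) \<and>
      (surj_form_system (sys F) D \<longrightarrow>
        (\<forall>l. \<exists>a\<in>forms t. \<forall>m\<in>mons 2. surj_form_system.residue (sys F) D (a * mon m) = l m)))"
    (is "open_special ?P")
    by (intro open_near_conj open_std_span open_top_degree open_codim_two open_perfect_pairing) simp
  fix F :: "nat \<Rightarrow> ('n, 'k) mpoly"
  assume F: "F \<in> form_tuples (2*n-2) e" and P: "?P F"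
  interpret form_system "sys F" D by (rule form_system_sys[OF F])
  have "surj subst_f"
  proof (rule surj_subst_f)
    show "\<exists>c. q = (\<Sum>m\<in>mons t'. cst (c m) * std_vec m)"
      if "t' \<le> Suc (Suc (Suc t))" "q \<in> forms t'" for t' q
      using P that by blast
    show "\<not> reduced m" if "mdeg m = Suc (Suc (Suc t))" for m
      using reduced_complement[of D m] mdeg_corner that by auto
  qed
  then interpret surj_form_system "sys F" D by unfold_locales
  have "non_koszul_ghost_term (2*n-2) e F C (n-1) (d-2)"
    if "minimal_graded_free_resolution (ideal F) C" for C :: "('b, ('n, 'k) mpoly) graded_seq"
  proof -
    have ghost: "ghost_term C (n - 1) (d - 2)"
      using that P surj_form_system_axioms
      by (intro ghost_term_of_generators[OF F]) (auto simp: minimal_graded_free_resolution_def)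
    then obtain r where "r \<in> copies C (Suc (n - 1)) (d - 2)"
      unfolding ghost_term_def by blast
    moreover have "Suc (n - 1) = n" using n3 by simp
    \<comment> \<open>The source of the induced map is zero, so the constant vector 1 is not hit at
      \<open>r\<close>.\<close>
    ultimately have "\<not> induced_surj (koszul (2*n-2) e F) C \<alpha> (Suc (n - 1)) (d - 2)" for \<alpha>
      unfolding induced_surj_def using koszul_no_copies[of F]
      by (auto simp: mat_app_def intro!: exI[of _ "\<lambda>_. 1"])
    with ghost show ?thesis
      unfolding non_koszul_ghost_term_def koszul_copies_def by blast
  qed
  moreover have "regular_sequence n F"
    using idx_\<iota> by (intro regular_sequence_f[OF \<iota>]) simp
  ultimately show "regular_sequence n F \<and>
     (\<forall>C :: ('b, ('n, 'k) mpoly) graded_seq.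
        minimal_graded_free_resolution (ideal F) C \<longrightarrow> non_koszul_ghost_term (2*n-2) e F C (n-1) (d-2))"
    by blast
qed

end

theorem corollary3p4:
  fixes n d :: nat and deg e :: "nat \<Rightarrow> nat"
  assumes "infinite (UNIV :: 'k::field set)"
    and "CARD('n::finite) = n" and "n \<ge> 3"
    and "2 < deg 1" and "mono_on {1..n} deg"
    and "d = (\<Sum>i=1..n. deg i)"
    and "\<forall>i\<in>{1..n}. e i = deg i" and "\<forall>i\<in>{n+1..2*n-2}. e i = d - n - 1"
  shows "for_general_forms (2*n-2) e (\<lambda>F :: nat \<Rightarrow> ('n, 'k) mpoly.
     regular_sequence n F \<and>
     (\<forall>C :: (nat, ('n, 'k) mpoly) graded_seq.
        minimal_graded_free_resolution (ideal_gen (F ` {1..2*n-2})) C \<longrightarrow>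
        non_koszul_ghost_term (2*n-2) e F C (n-1) (d-2)))"
proof -
  obtain \<iota> :: "nat \<Rightarrow> 'n" where \<iota>: "bij_betw \<iota> {1..n} UNIV"
    using finite_same_card_bij[of "{1..n}" "UNIV :: 'n set"] assms(2) by auto
  have "2 < deg i" if "i \<in> {1..n}" for i
    using monotone_onD[OF assms(5), of 1 i] that assms(3,4) by auto
  then interpret ghost_data n d deg e \<iota>
    using assms \<iota> by unfold_locales auto
  \<comment> \<open>The special tuple lies in the open set and witnesses that it is
    nonempty.\<close>
  show ?thesis
    by (rule open_near_imp_general[OF open_ghost_term special_tuple])
qed

end
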